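(* Let $(V,M)$ be a valuation domain with quotient field $L$, $M\neq0$, of the form $V=K+M$ with $K$ a subfield of $V$. Let $D$ be a subring of $K$ with quotient field $F$ and let $R=D+M$. Then: (10) $R$ is a local AV-domain $\iff$ $V$ is a DVR, $D=F$ is a field with $[K:F]<\infty$, and $F\subseteq K$ is a root extension. (11) $R$ is a quasilocal API-domain $\iff$ $V$ is a DVR, $D=F$ is a field, and $F\subseteq K$ is a bounded root extension (i.e. $K/F$ is purely inseparable of bounded exponent or $K$ is finite). (12) $R$ is a local API-domain $\iff$ $V$ is a DVR, $D=F$ is a field with $[K:F]<\infty$, and $F\subseteq K$ is a bounded root extension. (13) $R$ is a RAV-domain $\iff$ $V$ is a rational valuation domain, $D=F$ is a field, and $F\subseteq K$ is a root extension.
   Context: Quasilocal: unique maximal ideal; local: Noetherian and quasilocal. A root extension $R\subseteq S$: each $s\in S$ has some power in $R$; bounded if one exponent works for all $s$. AV-domain: for nonzero $a,b$ there is $n$ with $a^n\mid b^n$ or $b^n\mid a^n$. API-domain: for every nonempty subset $\{d_\alpha\}$ of nonzero elements some $n$ makes $(\{d_\alpha^n\})$ principal. DVR: local PID not a field. Rational valuation domain: valuation domain with value group order-isomorphic to a subgroup of $(\mathbb{Q},+)$. For a domain not a field, an almost uniformizing parameter is $a$ such that every nonzero nonunit $y$ satisfies $y^m=ua^n$ for some natural numbers $m,n$ and unit $u$; a RAV-domain is a domain having one. *)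

theory Defs
  imports Complex_Main
begin

text \<open>All rings live inside an ambient field of type 'a, which plays the role of
  the quotient field L of the valuation domain V.\<close>

definition is_subring :: "'a::field set \<Rightarrow> bool" where
  "is_subring S \<longleftrightarrow> 0 \<in> S \<and> 1 \<in> S \<and> (\<forall>x\<in>S. \<forall>y\<in>S. x + y \<in> S \<and> x * y \<in> S) \<and> (\<forall>x\<in>S. - x \<in> S)"

definition is_field_set :: "'a::field set \<Rightarrow> bool" where
  "is_field_set S \<longleftrightarrow> (\<forall>x\<in>S. x \<noteq> 0 \<longrightarrow> inverse x \<in> S)"

definition is_subfield :: "'a::field set \<Rightarrow> bool" where
  "is_subfield S \<longleftrightarrow> is_subring S \<and> is_field_set S"

definition r_dvd :: "'a::field set \<Rightarrow> 'a \<Rightarrow> 'a \<Rightarrow> bool" where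
  "r_dvd R a b \<longleftrightarrow> (\<exists>c\<in>R. b = a * c)"

definition r_unit :: "'a::field set \<Rightarrow> 'a \<Rightarrow> bool" where
  "r_unit R x \<longleftrightarrow> x \<in> R \<and> x \<noteq> 0 \<and> inverse x \<in> R"

definition r_ideal :: "'a::field set \<Rightarrow> 'a set \<Rightarrow> bool" where
  "r_ideal R I \<longleftrightarrow> I \<subseteq> R \<and> 0 \<in> I \<and> (\<forall>x\<in>I. \<forall>y\<in>I. x + y \<in> I) \<and> (\<forall>r\<in>R. \<forall>x\<in>I. r * x \<in> I)"

definition r_maximal :: "'a::field set \<Rightarrow> 'a set \<Rightarrow> bool" where
  "r_maximal R I \<longleftrightarrow> r_ideal R I \<and> I \<noteq> R \<and>
     (\<forall>J. r_ideal R J \<and> I \<subseteq> J \<and> J \<noteq> R \<longrightarrow> J = I)"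

definition quasilocal :: "'a::field set \<Rightarrow> bool" where
  "quasilocal R \<longleftrightarrow> (\<exists>!I. r_maximal R I)"

definition noetherian :: "'a::field set \<Rightarrow> bool" where
  "noetherian R \<longleftrightarrow> (\<forall>I :: nat \<Rightarrow> 'a set. (\<forall>n. r_ideal R (I n) \<and> I n \<subseteq> I (Suc n))
      \<longrightarrow> (\<exists>N. \<forall>n\<ge>N. I n = I N))"

definition local_dom :: "'a::field set \<Rightarrow> bool" where
  "local_dom R \<longleftrightarrow> noetherian R \<and> quasilocal R"

definition r_gen :: "'a::field set \<Rightarrow> 'a set \<Rightarrow> 'a set" where
  "r_gen R S = \<Inter>{I. r_ideal R I \<and> S \<subseteq> I}"

definition r_principal :: "'a::field set \<Rightarrow> 'a set \<Rightarrow> bool" where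
  "r_principal R I \<longleftrightarrow> (\<exists>x\<in>R. I = {r * x | r. r \<in> R})"

definition is_PID :: "'a::field set \<Rightarrow> bool" where
  "is_PID R \<longleftrightarrow> (\<forall>I. r_ideal R I \<longrightarrow> r_principal R I)"

definition is_DVR :: "'a::field set \<Rightarrow> bool" where
  "is_DVR R \<longleftrightarrow> local_dom R \<and> is_PID R \<and> \<not> is_field_set R"

definition AV_domain :: "'a::field set \<Rightarrow> bool" where
  "AV_domain R \<longleftrightarrow> (\<forall>a\<in>R. \<forall>b\<in>R. a \<noteq> 0 \<longrightarrow> b \<noteq> 0 \<longrightarrow>
      (\<exists>n>0. r_dvd R (a ^ n) (b ^ n) \<or> r_dvd R (b ^ n) (a ^ n)))"

definition API_domain :: "'a::field set \<Rightarrow> bool" where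
  "API_domain R \<longleftrightarrow> (\<forall>S. S \<noteq> {} \<longrightarrow> S \<subseteq> R - {0} \<longrightarrow>
      (\<exists>n>0. r_principal R (r_gen R ((\<lambda>d. d ^ n) ` S))))"

text \<open>V is a valuation domain whose quotient field is the ambient field 'a.\<close>
definition valuation_domain :: "'a::field set \<Rightarrow> bool" where
  "valuation_domain V \<longleftrightarrow> is_subring V \<and> (\<forall>x. x \<noteq> 0 \<longrightarrow> x \<in> V \<or> inverse x \<in> V)"

text \<open>Rational valuation domain: the value group (L^*/U(V), ordered by divisibility in V)
  admits an order-preserving group embedding into (Q,+); i.e. there is a valuation
  v : L^* -> Q with v(xy) = v x + v y whose nonnegativity set is exactly V.\<close>
definition rational_valuation_domain :: "'a::field set \<Rightarrow> bool" where
  "rational_valuation_domain V \<longleftrightarrow> valuation_domain V \<and>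
     (\<exists>v :: 'a \<Rightarrow> rat. (\<forall>x y. x \<noteq> 0 \<longrightarrow> y \<noteq> 0 \<longrightarrow> v (x * y) = v x + v y) \<and>
        (\<forall>x. x \<noteq> 0 \<longrightarrow> (x \<in> V \<longleftrightarrow> 0 \<le> v x)))"

definition almost_unif_param :: "'a::field set \<Rightarrow> 'a \<Rightarrow> bool" where
  "almost_unif_param R a \<longleftrightarrow> a \<in> R \<and> (\<forall>y\<in>R. y \<noteq> 0 \<longrightarrow> \<not> r_unit R y \<longrightarrow>
      (\<exists>m>0. \<exists>n>0. \<exists>u. r_unit R u \<and> y ^ m = u * a ^ n))"

definition RAV_domain :: "'a::field set \<Rightarrow> bool" where
  "RAV_domain R \<longleftrightarrow> \<not> is_field_set R \<and> (\<exists>a. almost_unif_param R a)"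

definition root_ext :: "'a::field set \<Rightarrow> 'a set \<Rightarrow> bool" where
  "root_ext F K \<longleftrightarrow> (\<forall>s\<in>K. \<exists>n>0. s ^ n \<in> F)"

definition bounded_root_ext :: "'a::field set \<Rightarrow> 'a set \<Rightarrow> bool" where
  "bounded_root_ext F K \<longleftrightarrow> (\<exists>n>0. \<forall>s\<in>K. s ^ n \<in> F)"

definition fin_dim :: "'a::field set \<Rightarrow> 'a set \<Rightarrow> bool" where
  "fin_dim F K \<longleftrightarrow> (\<exists>B. finite B \<and> B \<subseteq> K \<and>
      (\<forall>k\<in>K. \<exists>c. (\<forall>b\<in>B. c b \<in> F) \<and> k = (\<Sum>b\<in>B. c b * b)))"

definition max_ideal_of :: "'a::field set \<Rightarrow> 'a set" where
  "max_ideal_of V = {x \<in> V. \<not> r_unit V x}"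

definition frac_field :: "'a::field set \<Rightarrow> 'a set" where
  "frac_field D = {a / b | a b. a \<in> D \<and> b \<in> D \<and> b \<noteq> 0}"

definition set_plus :: "'a::field set \<Rightarrow> 'a set \<Rightarrow> 'a set" where
  "set_plus A B = {a + b | a b. a \<in> A \<and> b \<in> B}"

end

theory Submission
  imports Defs
begin

text \<open>Write \<open>R = D + M\<close>. Both the Noetherian and the API condition force the ascending chain
  condition on principal ideals of \<open>R\<close>. Applied to \<open>m / d ^ k\<close> it makes every nonzero \<open>d \<in> D\<close>
  invertible; applied to sequences in \<open>M\<close> it makes \<open>V\<close> discrete. The residue field extension is
  controlled by elements \<open>k * m\<close> with \<open>k \<in> K\<close> and \<open>0 \<noteq> m \<in> M\<close>: comparing \<open>k * m\<close> with \<open>m\<close> gives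
  \<open>k ^ n \<in> D\<close>, and the \<open>R\<close>-ideals \<open>m (W + M)\<close>, for \<open>W\<close> an \<open>F\<close>-subspace of \<open>K\<close>, transfer
  the Noetherian condition to finiteness of the dimension. Conversely, powers of units of \<open>V\<close> fall
  into \<open>R\<close> as soon as powers of their residues fall into \<open>F\<close>, so divisibility of powers in \<open>R\<close> is
  divisibility in \<open>V\<close>. An almost uniformizing parameter \<open>a\<close> embeds the value group in the rationals:
  \<open>x ^ m = u * a ^ n\<close> gives \<open>x\<close> the value \<open>n / m\<close>.\<close>

section \<open>Subrings of a field\<close>

lemma subringD:
  assumes "is_subring S"
  shows "0 \<in> S" "1 \<in> S" "x \<in> S \<Longrightarrow> y \<in> S \<Longrightarrow> x + y \<in> S" "x \<in> S \<Longrightarrow> y \<in> S \<Longrightarrow> x * y \<in> S"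
    "x \<in> S \<Longrightarrow> - x \<in> S" "x \<in> S \<Longrightarrow> y \<in> S \<Longrightarrow> x - y \<in> S"
  using assms unfolding is_subring_def by (auto simp: diff_conv_add_uminus simp del: add_uminus_conv_diff)

lemma subring_power: "is_subring S \<Longrightarrow> x \<in> S \<Longrightarrow> x ^ n \<in> S"
  by (induction n) (auto intro: subringD)

lemma frac_field_eq_iff:
  assumes "is_subring D"
  shows "D = frac_field D \<longleftrightarrow> is_field_set D"
proof
  assume eq: "D = frac_field D"
  have "inverse x \<in> frac_field D" if "x \<in> D" "x \<noteq> 0" for x
    unfolding frac_field_def inverse_eq_divide using that subringD(2)[OF assms] by blast
  then show "is_field_set D" using eq unfolding is_field_set_def by blast
next
  assume "is_field_set D"
  then have "a / b \<in> D" if "a \<in> D" "b \<in> D" "b \<noteq> 0" for a b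
    using that subringD(4)[OF assms] unfolding is_field_set_def by (simp add: divide_inverse)
  moreover have "x \<in> frac_field D" if "x \<in> D" for x
  proof -
    have "\<exists>a b. x = a / b \<and> a \<in> D \<and> b \<in> D \<and> b \<noteq> 0"
      by (rule exI[of _ x], rule exI[of _ 1]) (simp add: that subringD(2)[OF assms])
    then show ?thesis unfolding frac_field_def by blast
  qed
  ultimately show "D = frac_field D" unfolding frac_field_def by blast
qed

lemma principal_ideal:
  assumes "is_subring R" "x \<in> R"
  shows "r_ideal R {r * x | r. r \<in> R}"
  unfolding r_ideal_def
proof (intro conjI ballI)
  show "{r * x | r. r \<in> R} \<subseteq> R" using assms by (auto intro: subringD)
  show "0 \<in> {r * x | r. r \<in> R}" using subringD(1)[OF assms(1)] by force
next
  fix a b assume "a \<in> {r * x | r. r \<in> R}" "b \<in> {r * x | r. r \<in> R}"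
  then obtain r s where "a = r * x" "b = s * x" "r \<in> R" "s \<in> R" by blast
  then have "a + b = (r + s) * x" "r + s \<in> R" using subringD(3)[OF assms(1)] by (auto simp: algebra_simps)
  then show "a + b \<in> {r * x | r. r \<in> R}" by blast
next
  fix a b assume "a \<in> R" "b \<in> {r * x | r. r \<in> R}"
  then obtain r where "b = r * x" "r \<in> R" by blast
  then have "a * b = (a * r) * x" "a * r \<in> R" using subringD(4)[OF assms(1)] \<open>a \<in> R\<close> by (auto simp: algebra_simps)
  then show "a * b \<in> {r * x | r. r \<in> R}" by blast
qed

lemma ideal_Union_chain:
  fixes I :: "nat \<Rightarrow> 'a::field set"
  assumes "\<And>n. r_ideal R (I n)" "\<And>n. I n \<subseteq> I (Suc n)"
  shows "r_ideal R (\<Union>n. I n)"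
  unfolding r_ideal_def
proof (intro conjI ballI)
  show "(\<Union>n. I n) \<subseteq> R" "0 \<in> (\<Union>n. I n)" using assms(1) unfolding r_ideal_def by blast+
next
  fix x y assume "x \<in> (\<Union>n. I n)" "y \<in> (\<Union>n. I n)"
  then obtain i j where ij: "x \<in> I i" "y \<in> I j" by blast
  have mono: "I k \<subseteq> I l" if "k \<le> l" for k l using lift_Suc_mono_le[of I] assms(2) that by blast
  have "x \<in> I (max i j)" "y \<in> I (max i j)" using ij mono[of i "max i j"] mono[of j "max i j"] by auto
  then have "x + y \<in> I (max i j)" using assms(1)[of "max i j"] unfolding r_ideal_def by blast
  then show "x + y \<in> (\<Union>n. I n)" by blast
next
  fix r x assume "r \<in> R" "x \<in> (\<Union>n. I n)"
  then obtain n where "x \<in> I n" by blast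
  then have "r * x \<in> I n" using assms(1)[of n] \<open>r \<in> R\<close> unfolding r_ideal_def by blast
  then show "r * x \<in> (\<Union>n. I n)" by blast
qed

lemma r_gen_least: "r_ideal R I \<Longrightarrow> S \<subseteq> I \<Longrightarrow> r_gen R S \<subseteq> I"
  unfolding r_gen_def by blast

lemma r_gen_superset: "S \<subseteq> r_gen R S"
  unfolding r_gen_def by blast

text \<open>An ideal with an element outside \<open>M\<close> contains a unit, hence
  \<open>1\<close>, hence all of \<open>R\<close>. So every proper ideal lies in
  \<open>M\<close>.\<close>

lemma quasilocalI:
  assumes "is_subring R" "r_ideal R M" "1 \<notin> M" "\<And>r. r \<in> R \<Longrightarrow> r \<notin> M \<Longrightarrow> inverse r \<in> R"
  shows "quasilocal R"
proof -
  have proper: "J \<subseteq> M" if J: "r_ideal R J" "J \<noteq> R" for J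
  proof
    fix x assume "x \<in> J"
    show "x \<in> M"
    proof (rule ccontr)
      assume "x \<notin> M"
      then have "x \<in> R" "x \<noteq> 0" using \<open>x \<in> J\<close> J(1) assms(2) unfolding r_ideal_def by auto
      then have "inverse x \<in> R" using assms(4) \<open>x \<notin> M\<close> by blast
      then have "inverse x * x \<in> J" using \<open>x \<in> J\<close> J(1) unfolding r_ideal_def by blast
      then have "1 \<in> J" using \<open>x \<noteq> 0\<close> by simp
      then have "r * 1 \<in> J" if "r \<in> R" for r using J(1) that unfolding r_ideal_def by blast
      then show False using J unfolding r_ideal_def by auto
    qed
  qed
  have "M \<noteq> R" using assms(1,3) subringD(2) by blast
  then have "r_maximal R M" using proper assms(2) unfolding r_maximal_def by blast
  moreover have "I = M" if "r_maximal R I" for I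
    using that proper[of I] assms(2) \<open>M \<noteq> R\<close> unfolding r_maximal_def by blast
  ultimately show ?thesis unfolding quasilocal_def by blast
qed

text \<open>A generator of the union of the chain already lies in some \<open>I N\<close>, and the
  chain stops there.\<close>

lemma PID_noetherian:
  assumes "is_PID R" "is_subring R"
  shows "noetherian R"
  unfolding noetherian_def
proof (intro allI impI)
  fix I :: "nat \<Rightarrow> 'a set"
  assume I: "\<forall>n. r_ideal R (I n) \<and> I n \<subseteq> I (Suc n)"
  then have "r_ideal R (\<Union>n. I n)" by (intro ideal_Union_chain) auto
  then obtain x where x: "(\<Union>n. I n) = {r * x | r. r \<in> R}"
    using assms(1) unfolding is_PID_def r_principal_def by blast
  have "1 * x \<in> (\<Union>n. I n)" unfolding x using subringD(2)[OF assms(2)] by blast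
  then obtain N where N: "x \<in> I N" by auto
  have "I n = I N" if "n \<ge> N" for n
  proof
    show "I N \<subseteq> I n" using lift_Suc_mono_le[of I] I that by blast
    have "I n \<subseteq> {r * x | r. r \<in> R}" using x by blast
    also have "\<dots> \<subseteq> I N" using N I unfolding r_ideal_def by blast
    finally show "I n \<subseteq> I N" .
  qed
  then show "\<exists>N. \<forall>n\<ge>N. I n = I N" by blast
qed

section \<open>Ascending chain condition on principal ideals\<close>

text \<open>Inclusion of principal ideals is encoded by quotients in the ambient field:
  \<open>x n / x (Suc n) \<in> R\<close> means that \<open>x n\<close> lies in the ideal of
  \<open>x (Suc n)\<close>, and the second quotient expresses strictness.\<close>

definition ACCP :: "'a::field set \<Rightarrow> bool" where
  "ACCP R \<longleftrightarrow> \<not> (\<exists>x :: nat \<Rightarrow> 'a. \<forall>n. x n \<in> R \<and> x n \<noteq> 0 \<and>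
     x n / x (Suc n) \<in> R \<and> x (Suc n) / x n \<notin> R)"

lemma ACCP_D:
  assumes "ACCP R" "\<And>n. x n \<in> R \<and> x n \<noteq> 0 \<and> x n / x (Suc n) \<in> R"
  shows "\<exists>n. x (Suc n) / x n \<in> R"
  using assms unfolding ACCP_def by blast

lemma principal_chain:
  fixes x :: "nat \<Rightarrow> 'a::field"
  assumes "is_subring R" "\<And>n. x n \<in> R \<and> x n \<noteq> 0 \<and> x n / x (Suc n) \<in> R"
  shows "{r * x n | r. r \<in> R} \<subseteq> {r * x (Suc n) | r. r \<in> R}"
proof
  fix y assume "y \<in> {r * x n | r. r \<in> R}"
  then obtain r where "y = r * x n" "r \<in> R" by blast
  then have "y = (r * (x n / x (Suc n))) * x (Suc n)" using assms(2)[of "Suc n"] by simp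
  moreover have "r * (x n / x (Suc n)) \<in> R"
    using \<open>r \<in> R\<close> assms(2)[of n] subringD(4)[OF assms(1)] by blast
  ultimately show "y \<in> {r * x (Suc n) | r. r \<in> R}" by blast
qed

lemma noetherian_ACCP:
  assumes "noetherian R" "is_subring R"
  shows "ACCP R"
  unfolding ACCP_def
proof
  assume "\<exists>x :: nat \<Rightarrow> 'a. \<forall>n. x n \<in> R \<and> x n \<noteq> 0 \<and> x n / x (Suc n) \<in> R \<and> x (Suc n) / x n \<notin> R"
  then obtain x :: "nat \<Rightarrow> 'a"
    where x: "\<And>n. x n \<in> R \<and> x n \<noteq> 0 \<and> x n / x (Suc n) \<in> R" "\<And>n. x (Suc n) / x n \<notin> R" by blast
  let ?I = "\<lambda>n. {r * x n | r. r \<in> R}"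
  have "\<forall>n. r_ideal R (?I n) \<and> ?I n \<subseteq> ?I (Suc n)"
    using principal_chain[where x=x, OF assms(2) x(1)] principal_ideal[OF assms(2)] x(1) by blast
  from assms(1)[unfolded noetherian_def, rule_format, of ?I, OF this[rule_format]]
  obtain N where N: "\<forall>n\<ge>N. ?I n = ?I N" by blast
  have "?I (Suc N) = ?I N" by (rule N[rule_format]) simp
  moreover have "1 * x (Suc N) \<in> ?I (Suc N)" using subringD(2)[OF assms(2)] by blast
  ultimately obtain r where "x (Suc N) = r * x N" "r \<in> R" by auto
  then show False using x(1)[of N] x(2)[of N] by simp
qed

text \<open>For a suitable \<open>k\<close> the ideal generated by all \<open>x n ^ k\<close> is
  principal. It lies in the union of the ideals of the \<open>x n ^ k\<close>, so its generator lies
  in one of them and the chain of powers stops. It remains to pass from powers back to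
  elements.\<close>

lemma API_ACCP:
  assumes "API_domain R" "is_subring R"
  shows "ACCP R"
  unfolding ACCP_def
proof
  assume "\<exists>x :: nat \<Rightarrow> 'a. \<forall>n. x n \<in> R \<and> x n \<noteq> 0 \<and> x n / x (Suc n) \<in> R \<and> x (Suc n) / x n \<notin> R"
  then obtain x :: "nat \<Rightarrow> 'a"
    where x: "\<And>n. x n \<in> R \<and> x n \<noteq> 0 \<and> x n / x (Suc n) \<in> R" "\<And>n. x (Suc n) / x n \<notin> R" by blast
  have "range x \<noteq> {}" "range x \<subseteq> R - {0}" using x(1) by auto
  then obtain k where k: "k > 0" "r_principal R (r_gen R ((\<lambda>d. d ^ k) ` range x))"
    using assms(1) unfolding API_domain_def by blast
  then obtain y where y: "r_gen R ((\<lambda>d. d ^ k) ` range x) = {r * y | r. r \<in> R}"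
    unfolding r_principal_def by blast
  let ?x = "\<lambda>n. x n ^ k"
  have xk: "?x n \<in> R \<and> ?x n \<noteq> 0 \<and> ?x n / ?x (Suc n) \<in> R" for n
    using x(1)[of n] x(1)[of "Suc n"] subring_power[OF assms(2)]
    by (auto simp: power_divide[symmetric])
  let ?I = "\<lambda>n. {r * ?x n | r. r \<in> R}"
  have "r_ideal R (\<Union>n. ?I n)"
    using principal_chain[where x="?x", OF assms(2) xk] principal_ideal[OF assms(2)] xk
    by (intro ideal_Union_chain) blast+
  moreover have "1 * ?x n \<in> ?I n" for n using subringD(2)[OF assms(2)] by blast
  then have "(\<lambda>d. d ^ k) ` range x \<subseteq> (\<Union>n. ?I n)" by auto
  ultimately have "{r * y | r. r \<in> R} \<subseteq> (\<Union>n. ?I n)"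
    unfolding y[symmetric] by (rule r_gen_least)
  moreover have "1 * y \<in> {r * y | r. r \<in> R}" using subringD(2)[OF assms(2)] by blast
  ultimately obtain N r where r: "y = r * ?x N" "r \<in> R" by auto
  have "?x (Suc N) \<in> {r * y | r. r \<in> R}"
    unfolding y[symmetric] by (rule subsetD[OF r_gen_superset]) simp
  then obtain s where s: "?x (Suc N) = s * y" "s \<in> R" by blast
  define q where "q = x (Suc N) / x N"
  have nz: "x N \<noteq> 0" "x (Suc N) \<noteq> 0" using x(1) by auto
  have "q ^ k = s * r" using r s nz unfolding q_def by (simp add: power_divide)
  then have "q ^ k \<in> R" using r s subringD(4)[OF assms(2)] by simp
  moreover have "inverse q \<in> R" using x(1)[of N] unfolding q_def by simp
  \<comment> \<open>Since \<open>inverse q\<close> lies in \<open>R\<close>, the power can be undone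
    inside \<open>R\<close> by \<open>k - 1\<close> factors \<open>inverse q\<close>.\<close>
  moreover have "q = q ^ k * inverse q ^ (k - 1)"
    using k(1) nz unfolding q_def by (cases k) (auto simp: field_simps)
  ultimately have "q \<in> R" using subringD(4)[OF assms(2)] subring_power[OF assms(2)] by metis
  then show False using x(2) unfolding q_def by blast
qed

section \<open>Submodules over a subring\<close>

definition submod :: "'a::field set \<Rightarrow> 'a set \<Rightarrow> bool" where
  "submod F W \<longleftrightarrow> 0 \<in> W \<and> (\<forall>x\<in>W. \<forall>y\<in>W. x + y \<in> W) \<and> (\<forall>c\<in>F. \<forall>x\<in>W. c * x \<in> W)"

text \<open>Defined as an intersection, so that exhibiting one submodule bounds a span;
  \<open>fspan_finite_sum\<close> recovers the linear combinations.\<close>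

definition fspan :: "'a::field set \<Rightarrow> 'a set \<Rightarrow> 'a set" where
  "fspan F G = \<Inter>{W. submod F W \<and> G \<subseteq> W}"

lemma submodD:
  assumes "submod F W"
  shows "0 \<in> W" "x \<in> W \<Longrightarrow> y \<in> W \<Longrightarrow> x + y \<in> W" "c \<in> F \<Longrightarrow> x \<in> W \<Longrightarrow> c * x \<in> W"
  using assms unfolding submod_def by auto

lemma submod_diff:
  assumes "is_subring F" "submod F W" "x \<in> W" "y \<in> W"
  shows "x - y \<in> W"
proof -
  have "-1 * y \<in> W" using assms subringD(2,5) submodD(3) by blast
  then have "x + -1 * y \<in> W" using submodD(2)[OF assms(2)] assms(3) by blast
  then show ?thesis by simp
qed

lemma submod_fspan: "submod F (fspan F G)"
  unfolding fspan_def submod_def by blast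

lemma fspan_superset: "G \<subseteq> fspan F G"
  unfolding fspan_def by blast

lemma fspan_least: "submod F W \<Longrightarrow> G \<subseteq> W \<Longrightarrow> fspan F G \<subseteq> W"
  unfolding fspan_def by blast

lemma fspan_mono: "G \<subseteq> H \<Longrightarrow> fspan F G \<subseteq> fspan F H"
  unfolding fspan_def by blast

lemma submod_sum:
  assumes "is_subring F" "submod F A" "submod F B"
  shows "submod F {a + b | a b. a \<in> A \<and> b \<in> B}"
  unfolding submod_def
proof (intro conjI ballI)
  show "0 \<in> {a + b | a b. a \<in> A \<and> b \<in> B}" using assms submodD(1) by force
next
  fix x y assume "x \<in> {a + b | a b. a \<in> A \<and> b \<in> B}" "y \<in> {a + b | a b. a \<in> A \<and> b \<in> B}"
  then obtain a b a' b' where *: "x = a + b" "y = a' + b'" "a \<in> A" "b \<in> B" "a' \<in> A" "b' \<in> B"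
    by blast
  have "x + y = (a + a') + (b + b')" "a + a' \<in> A" "b + b' \<in> B"
    using * assms submodD(2) by (auto simp: algebra_simps)
  then show "x + y \<in> {a + b | a b. a \<in> A \<and> b \<in> B}" by blast
next
  fix c x assume "c \<in> F" "x \<in> {a + b | a b. a \<in> A \<and> b \<in> B}"
  then obtain a b where *: "x = a + b" "a \<in> A" "b \<in> B" by blast
  then have "c * x = c * a + c * b" "c * a \<in> A" "c * b \<in> B"
    using submodD(3)[OF assms(2) \<open>c \<in> F\<close>] submodD(3)[OF assms(3) \<open>c \<in> F\<close>]
    by (simp_all only: distrib_left)
  then show "c * x \<in> {a + b | a b. a \<in> A \<and> b \<in> B}" by blast
qed

lemma submod_line:
  assumes "is_subring F"
  shows "submod F {c * b | c. c \<in> F}"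
  unfolding submod_def
proof (intro conjI ballI)
  show "0 \<in> {c * b | c. c \<in> F}" using subringD(1)[OF assms] by force
next
  fix x y assume "x \<in> {c * b | c. c \<in> F}" "y \<in> {c * b | c. c \<in> F}"
  then obtain c d where "x = c * b" "y = d * b" "c \<in> F" "d \<in> F" by blast
  then have "x + y = (c + d) * b" "c + d \<in> F" using subringD(3)[OF assms] by (auto simp: algebra_simps)
  then show "x + y \<in> {c * b | c. c \<in> F}" by blast
next
  fix e x assume "e \<in> F" "x \<in> {c * b | c. c \<in> F}"
  then obtain c where "x = c * b" "c \<in> F" by blast
  then have "e * x = (e * c) * b" "e * c \<in> F" using subringD(4)[OF assms] \<open>e \<in> F\<close> by (auto simp: algebra_simps)
  then show "e * x \<in> {c * b | c. c \<in> F}" by blast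
qed

text \<open>The elements \<open>y + c * b\<close> form a submodule that contains \<open>b\<close>
  and \<open>G\<close>.\<close>

lemma fspan_insert:
  assumes "is_subring F" "x \<in> fspan F (insert b G)"
  obtains y c where "x = y + c * b" "y \<in> fspan F G" "c \<in> F"
proof -
  let ?W = "{y + z | y z. y \<in> fspan F G \<and> z \<in> {c * b | c. c \<in> F}}"
  have "submod F ?W" by (rule submod_sum[OF assms(1) submod_fspan submod_line[OF assms(1)]])
  moreover have "insert b G \<subseteq> ?W"
  proof -
    have "0 + 1 * b \<in> ?W" using submodD(1)[OF submod_fspan] subringD(2)[OF assms(1)] by blast
    moreover have "g + 0 * b \<in> ?W" if "g \<in> G" for g
      using fspan_superset that subringD(1)[OF assms(1)] by blast
    ultimately show ?thesis by auto
  qed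
  ultimately have "x \<in> ?W" using fspan_least assms(2) by blast
  then show ?thesis using that by blast
qed

lemma finite_sum_in_submod:
  assumes "finite B" "submod F W" "B \<subseteq> W" "\<And>b. b \<in> B \<Longrightarrow> c b \<in> F"
  shows "(\<Sum>b\<in>B. c b * b) \<in> W"
  using assms by (induction B rule: finite_induct) (auto intro: submodD)

lemma fspan_finite_sum:
  assumes "is_subring F" "finite B" "x \<in> fspan F B"
  shows "\<exists>c. (\<forall>b\<in>B. c b \<in> F) \<and> x = (\<Sum>b\<in>B. c b * b)"
  using assms(2,3)
proof (induction B arbitrary: x rule: finite_induct)
  case empty
  have "submod F {0}" unfolding submod_def by auto
  then show ?case using fspan_least[of F "{0}" "{}"] empty by auto
next
  case (insert b B)
  obtain y d where y: "x = y + d * b" "y \<in> fspan F B" "d \<in> F"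
    using fspan_insert[OF assms(1) insert.prems] .
  obtain c where c: "\<forall>b\<in>B. c b \<in> F" "y = (\<Sum>b\<in>B. c b * b)" using insert.IH[OF y(2)] by blast
  have "(\<Sum>a\<in>B. (c(b := d)) a * a) = (\<Sum>a\<in>B. c a * a)"
    using insert.hyps(2) by (intro sum.cong) auto
  then have "x = (\<Sum>a\<in>insert b B. (c(b := d)) a * a)"
    using y c insert.hyps by (simp add: add.commute)
  moreover have "\<forall>a\<in>insert b B. (c(b := d)) a \<in> F" using c y by simp
  ultimately show ?case by blast
qed

text \<open>Replaces coefficient families by spans, the form in which both directions of the
  Noetherian criterion use finite dimension.\<close>

lemma fin_dim_iff:
  assumes "is_subring F"
  shows "fin_dim F K \<longleftrightarrow> (\<exists>B. finite B \<and> B \<subseteq> K \<and> K \<subseteq> fspan F B)"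
proof
  assume "fin_dim F K"
  then obtain B where B: "finite B" "B \<subseteq> K" "\<forall>k\<in>K. \<exists>c. (\<forall>b\<in>B. c b \<in> F) \<and> k = (\<Sum>b\<in>B. c b * b)"
    unfolding fin_dim_def by blast
  have "K \<subseteq> fspan F B"
  proof
    fix k assume "k \<in> K"
    then obtain c where "\<forall>b\<in>B. c b \<in> F" "k = (\<Sum>b\<in>B. c b * b)" using B(3) by blast
    then show "k \<in> fspan F B"
      using finite_sum_in_submod[OF B(1) submod_fspan fspan_superset, of c] by simp
  qed
  then show "\<exists>B. finite B \<and> B \<subseteq> K \<and> K \<subseteq> fspan F B" using B by blast
next
  assume "\<exists>B. finite B \<and> B \<subseteq> K \<and> K \<subseteq> fspan F B"
  then obtain B where B: "finite B" "B \<subseteq> K" "K \<subseteq> fspan F B" by blast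
  then have "\<forall>k\<in>K. \<exists>c. (\<forall>b\<in>B. c b \<in> F) \<and> k = (\<Sum>b\<in>B. c b * b)"
    using fspan_finite_sum[OF assms B(1)] by (meson subsetD)
  with B show "fin_dim F K" unfolding fin_dim_def by blast
qed

text \<open>Going from \<open>G\<close> to \<open>insert b G\<close>: once some \<open>w \<in> W N\<close> involves \<open>b\<close>, subtracting a multiple of
  \<open>w\<close> moves any later element into the span of \<open>Z \<union> G\<close>, where the chain is stationary.\<close>
lemma submod_chain_stationary:
  fixes W :: "nat \<Rightarrow> 'a::field set"
  assumes F: "is_subfield F" and "finite G" and Z: "submod F Z"
    and "\<And>n. submod F (W n)" "\<And>n. W n \<subseteq> W (Suc n)" "\<And>n. Z \<subseteq> W n" "\<And>n. W n \<subseteq> fspan F (Z \<union> G)"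
  shows "\<exists>N. \<forall>n\<ge>N. W n = W N"
  using assms(2,4-)
proof (induction G arbitrary: W rule: finite_induct)
  case empty
  have "fspan F Z \<subseteq> Z" using fspan_least[OF Z] by blast
  then have "W n = Z" for n using empty(3)[of n] empty(4)[of n] by auto
  then show ?case by simp
next
  case (insert b G W)
  have Fr: "is_subring F" using F unfolding is_subfield_def by blast
  let ?A = "fspan F (Z \<union> G)"
  have mono: "W k \<subseteq> W l" if "k \<le> l" for k l using lift_Suc_mono_le[of W] insert.prems(2) that by blast
  \<comment> \<open>Intersected with \<open>?A\<close>, the chain lies in a span with one generator
    fewer, so the induction hypothesis applies.\<close>
  have "\<exists>N. \<forall>n\<ge>N. W n \<inter> ?A = W N \<inter> ?A"
  proof (rule insert.IH)
    show "submod F (W n \<inter> ?A)" for n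
      using insert.prems(1)[of n] submod_fspan[of F "Z \<union> G"] unfolding submod_def by auto
    show "Z \<subseteq> W n \<inter> ?A" for n using insert.prems(3)[of n] fspan_superset[of "Z \<union> G" F] by blast
    show "W n \<inter> ?A \<subseteq> W (Suc n) \<inter> ?A" for n using insert.prems(2)[of n] by blast
  qed auto
  then obtain N where N: "\<And>n. n \<ge> N \<Longrightarrow> W n \<inter> ?A = W N \<inter> ?A" by blast
  show ?case
  proof (cases "\<forall>n. W n \<subseteq> ?A")
    case True
    then show ?thesis using N by (intro exI[of _ N]) blast
  next
    case False
    then obtain N' w where w: "w \<in> W N'" "w \<notin> ?A" by blast
    have ins: "Z \<union> insert b G = insert b (Z \<union> G)" by simp
    have "w \<in> fspan F (insert b (Z \<union> G))" using insert.prems(4)[of N'] w(1) unfolding ins by blast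
    then obtain y c where y: "w = y + c * b" "y \<in> ?A" "c \<in> F"
      using fspan_insert[OF Fr] by blast
    have c: "c \<noteq> 0" using y w by auto
    let ?m = "max N N'"
    have "W n = W ?m" if n: "n \<ge> ?m" for n
    proof
      show "W ?m \<subseteq> W n" using mono n .
      show "W n \<subseteq> W ?m"
      proof
        fix x assume x: "x \<in> W n"
        then have "x \<in> fspan F (insert b (Z \<union> G))" using insert.prems(4)[of n] unfolding ins by blast
        then obtain y' c' where y': "x = y' + c' * b" "y' \<in> ?A" "c' \<in> F"
          using fspan_insert[OF Fr] by blast
        \<comment> \<open>The ratio of the two coefficients of \<open>b\<close>, so that
          \<open>b\<close> cancels in \<open>x - e * w\<close>. Dividing by \<open>c\<close> uses
          that \<open>F\<close> is a field.\<close>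
        define e where "e = c' * inverse c"
        have e: "e \<in> F" using y y' c F subringD(4)[OF Fr]
          unfolding e_def is_subfield_def is_field_set_def by blast
        have ew: "e * w \<in> W ?m" using submodD(3)[OF insert.prems(1) e] w(1) mono[of N' ?m] by auto
        then have "x - e * w \<in> W n" using submod_diff[OF Fr insert.prems(1) x] mono[OF n] by blast
        moreover have "x - e * w = y' - e * y"
          using c unfolding e_def y(1) y'(1) by (simp add: field_simps)
        moreover have "y' - e * y \<in> ?A"
          using submod_diff[OF Fr submod_fspan y'(2)] submodD(3)[OF submod_fspan e y(2)] by blast
        ultimately have "x - e * w \<in> W N" using N[of n] n by auto
        then have "x - e * w \<in> W ?m" using mono[of N ?m] by auto
        from submodD(2)[OF insert.prems(1) this ew] show "x \<in> W ?m" by simp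
      qed
    qed
    then show ?thesis by blast
  qed
qed

section \<open>Valuation domains\<close>

locale valuation_ring =
  fixes V M :: "'a::field set"
  assumes val: "valuation_domain V"
    and M_eq: "M = max_ideal_of V"
begin

lemma V_subring: "is_subring V"
  using val unfolding valuation_domain_def by blast

lemmas V_intros = subringD[OF V_subring] subring_power[OF V_subring]

lemma V_total: "x \<noteq> 0 \<Longrightarrow> x \<notin> V \<Longrightarrow> inverse x \<in> V"
  using val unfolding valuation_domain_def by blast

lemma M_iff: "x \<in> M \<longleftrightarrow> x \<in> V \<and> (x = 0 \<or> inverse x \<notin> V)"
  unfolding M_eq max_ideal_of_def r_unit_def by blast

lemma M_sub_V: "M \<subseteq> V"
  using M_iff by blast

lemma not_in_V: "x \<notin> V \<Longrightarrow> inverse x \<in> M \<and> x \<noteq> 0"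
  using V_total[of x] M_iff[of "inverse x"] V_intros(1) by auto

lemma M_zero: "0 \<in> M"
  using M_iff V_intros(1) by blast

lemma M_one: "1 \<notin> M"
  using M_iff V_intros(2) by simp

lemma M_mult: "x \<in> V \<Longrightarrow> y \<in> M \<Longrightarrow> x * y \<in> M"
proof (cases "x * y = 0")
  case False
  assume xy: "x \<in> V" "y \<in> M"
  have "inverse (x * y) \<notin> V"
  proof
    assume "inverse (x * y) \<in> V"
    then have "x * inverse (x * y) \<in> V" using xy V_intros(4) by blast
    then have "inverse y \<in> V" using False by (simp add: field_simps)
    then show False using xy False M_iff by auto
  qed
  then show ?thesis using xy M_iff V_intros(4) by blast
qed (auto simp: M_zero)

lemma M_mult_right: "y \<in> M \<Longrightarrow> x \<in> V \<Longrightarrow> y * x \<in> M"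
  using M_mult by (simp add: mult.commute)

text \<open>If \<open>y\<close> divides \<open>x\<close> in \<open>V\<close>, then
  \<open>x + y\<close> is a \<open>V\<close>-multiple of \<open>y\<close>. Divisibility in
  \<open>V\<close> is total, so up to order this covers all nonzero pairs.\<close>

lemma M_add_aux:
  assumes "x \<in> M" "y \<in> M" "y \<noteq> 0" "x / y \<in> V"
  shows "x + y \<in> M"
proof -
  have "(x / y + 1) * y \<in> M" using assms V_intros(2,3) by (intro M_mult) auto
  moreover have "(x / y + 1) * y = x + y" using assms(3) by (simp add: field_simps)
  ultimately show ?thesis by simp
qed

lemma M_add: "x \<in> M \<Longrightarrow> y \<in> M \<Longrightarrow> x + y \<in> M"
proof (cases "x = 0 \<or> y = 0")
  case False
  assume xy: "x \<in> M" "y \<in> M"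
  have "x / y \<in> V \<or> y / x \<in> V" using V_total[of "x / y"] False by auto
  then show ?thesis using M_add_aux[of x y] M_add_aux[of y x] xy False by (auto simp: add.commute)
qed auto

lemma M_uminus: "x \<in> M \<Longrightarrow> - x \<in> M"
  using M_mult[of "-1" x] V_intros(2,5) by auto

lemma M_diff: "x \<in> M \<Longrightarrow> y \<in> M \<Longrightarrow> x - y \<in> M"
  using M_add[of x "-y"] M_uminus by simp

lemma M_ideal: "r_ideal V M"
  unfolding r_ideal_def using M_sub_V M_zero M_add M_mult by auto

lemma V_quasilocal: "quasilocal V"
  using V_subring M_ideal M_one by (rule quasilocalI) (use M_iff in blast)

text \<open>Integral closedness of \<open>V\<close> for pure roots: if \<open>x\<close> is outside
  \<open>V\<close>, its inverse is inside and lowers \<open>x ^ n\<close> to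
  \<open>x\<close>.\<close>

lemma power_in_V: "n > 0 \<Longrightarrow> x ^ n \<in> V \<longleftrightarrow> x \<in> V"
proof
  assume n: "n > 0" and xn: "x ^ n \<in> V"
  show "x \<in> V"
  proof (rule ccontr)
    assume "x \<notin> V"
    then have "inverse x \<in> M" "x \<noteq> 0" using not_in_V by blast+
    then have "x ^ n * inverse x ^ (n - 1) \<in> V"
      using xn V_intros(4,7) M_sub_V by (meson subsetD)
    moreover have "x ^ n * inverse x ^ (n - 1) = x"
      using n \<open>x \<noteq> 0\<close> by (cases n) (auto simp: field_simps)
    ultimately show False using \<open>x \<notin> V\<close> by simp
  qed
qed (simp add: V_intros)

lemma unit_mult: "r_unit V u \<Longrightarrow> r_unit V w \<Longrightarrow> r_unit V (u * w)"
  unfolding r_unit_def by (simp add: V_intros)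

lemma unit_inverse: "r_unit V u \<Longrightarrow> r_unit V (inverse u)"
  unfolding r_unit_def by simp

lemma unit_power: "r_unit V u \<Longrightarrow> r_unit V (u ^ n)"
  unfolding r_unit_def by (simp add: V_intros power_inverse[symmetric])

lemma unit_iff: "r_unit V u \<longleftrightarrow> u \<in> V \<and> u \<notin> M"
  unfolding r_unit_def M_iff by blast

section \<open>Uniformizers and discreteness of the valuation\<close>

definition uniformizer :: "'a \<Rightarrow> bool" where
  "uniformizer t \<longleftrightarrow> t \<in> M \<and> t \<noteq> 0 \<and> (\<forall>x\<in>V. x \<noteq> 0 \<longrightarrow> (\<exists>k u. r_unit V u \<and> x = u * t ^ k))"

text \<open>Divide \<open>p\<close> by \<open>t\<close> as long as the result stays in
  \<open>V\<close>. The last quotient is outside \<open>M\<close>, because elements of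
  \<open>M\<close> are still divisible by \<open>t\<close>; so it is a unit.\<close>

lemma uniformizerI:
  assumes t: "t \<in> M" "t \<noteq> 0" and gen: "\<And>x. x \<in> M \<Longrightarrow> x / t \<in> V"
    and arch: "\<And>p. p \<in> V \<Longrightarrow> p \<noteq> 0 \<Longrightarrow> \<exists>k. p / t ^ k \<notin> V"
  shows "uniformizer t"
  unfolding uniformizer_def
proof (intro conjI ballI impI)
  fix p assume p: "p \<in> V" "p \<noteq> 0"
  define k where "k = (LEAST k. p / t ^ k \<notin> V)"
  have k: "p / t ^ k \<notin> V" unfolding k_def by (rule LeastI_ex[OF arch[OF p]])
  \<comment> \<open>The case \<open>k = 0\<close> is excluded by \<open>p \<in> V\<close>;
    \<open>j\<close> is the last exponent at which the quotient stays in \<open>V\<close>.\<close>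
  then obtain j where j: "k = Suc j" using p by (cases k) auto
  have "p / t ^ j \<in> V" using not_less_Least[of j "\<lambda>k. p / t ^ k \<notin> V"] j unfolding k_def by auto
  moreover have "p / t ^ j \<notin> M" using gen[of "p / t ^ j"] k j by (auto simp: mult.commute)
  ultimately have "r_unit V (p / t ^ j)" unfolding unit_iff by blast
  moreover have "p = (p / t ^ j) * t ^ j" using t by simp
  ultimately show "\<exists>k u. r_unit V u \<and> p = u * t ^ k" by blast
qed (use t in auto)

text \<open>A ratio in \<open>M\<close> lies in \<open>R\<close>, while its inverse is outside
  \<open>V\<close> and so outside \<open>R\<close>: the principal ideals would increase strictly.
  Allowing any \<open>R\<close> between \<open>M\<close> and \<open>V\<close> serves both
  \<open>V\<close> itself and \<open>D + M\<close>.\<close>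

lemma no_descending_sequence:
  assumes "ACCP R" "M \<subseteq> R" "R \<subseteq> V" "\<And>n :: nat. x n \<in> M \<and> x n \<noteq> 0"
  shows "\<exists>n. x n / x (Suc n) \<notin> M"
proof (rule ccontr)
  assume "\<nexists>n. x n / x (Suc n) \<notin> M"
  then have q: "x n / x (Suc n) \<in> M" for n by blast
  have "x (Suc n) / x n \<notin> R" for n
    using q[of n] assms(3,4) M_iff[of "x n / x (Suc n)"] by auto
  then show False using assms q unfolding ACCP_def by blast
qed

lemma ACCP_uniformizer:
  assumes "ACCP R" "M \<subseteq> R" "R \<subseteq> V" "M \<noteq> {0}"
  shows "\<exists>t. uniformizer t"
proof -
  obtain m where m: "m \<in> M" "m \<noteq> 0" using assms(4) M_zero by blast
  \<comment> \<open>An element of least positive value. If there were none, every \<open>t\<close>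
    would have some \<open>s\<close> in \<open>M\<close> with \<open>t / s \<in> M\<close>, and
    iterating contradicts \<open>no_descending_sequence\<close>.\<close>
  have "\<exists>t. t \<in> M \<and> t \<noteq> 0 \<and> (\<forall>x\<in>M. x / t \<in> V)"
  proof (rule ccontr)
    assume neg: "\<not> ?thesis"
    have step: "\<exists>s. (s \<in> M \<and> s \<noteq> 0) \<and> t / s \<in> M" if t: "t \<in> M \<and> t \<noteq> 0" for t
    proof -
      obtain s where s: "s \<in> M" "s / t \<notin> V" using neg t by blast
      then show ?thesis using not_in_V[of "s / t"] by auto
    qed
    have "\<exists>x. \<forall>n. (x n \<in> M \<and> x n \<noteq> 0) \<and> x n / x (Suc n) \<in> M"
      by (rule dependent_nat_choice[where P="\<lambda>_ t. t \<in> M \<and> t \<noteq> 0" and Q="\<lambda>_ t s. t / s \<in> M"])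
        (use m step in auto)
    then show False using no_descending_sequence[OF assms(1-3)] by blast
  qed
  then obtain t where t: "t \<in> M" "t \<noteq> 0" "\<And>x. x \<in> M \<Longrightarrow> x / t \<in> V" by blast
  \<comment> \<open>Otherwise all \<open>p / t ^ k\<close> would lie in \<open>M\<close>, with
    constant consecutive ratio \<open>t \<in> M\<close>.\<close>
  have "\<exists>k. p / t ^ k \<notin> V" if p: "p \<in> V" "p \<noteq> 0" for p
  proof (rule ccontr)
    assume "\<nexists>k. p / t ^ k \<notin> V"
    then have pV: "p / t ^ k \<in> V" for k by blast
    have "p / t ^ k = (p / t ^ Suc k) * t" for k using t by simp
    then have "p / t ^ k \<in> M \<and> p / t ^ k \<noteq> 0" for k
      using M_mult[OF pV[of "Suc k"] t(1)] p t by (metis divide_eq_0_iff power_not_zero)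
    then obtain k where "(p / t ^ k) / (p / t ^ Suc k) \<notin> M"
      using no_descending_sequence[OF assms(1-3), of "\<lambda>k. p / t ^ k"] by blast
    then show False using t p by simp
  qed
  then show ?thesis using uniformizerI[OF t] by blast
qed

text \<open>An element of \<open>S\<close> with the least exponent of \<open>t\<close> divides all
  the others in \<open>V\<close>.\<close>

lemma uniformizer_min:
  assumes "uniformizer t" "S \<noteq> {}" "S \<subseteq> V - {0}"
  shows "\<exists>s\<in>S. \<forall>x\<in>S. x / s \<in> V"
proof -
  let ?P = "\<lambda>k. \<exists>s\<in>S. \<exists>u. r_unit V u \<and> s = u * t ^ k"
  have ex: "\<exists>k u. r_unit V u \<and> s = u * t ^ k" if "s \<in> S" for s
    using assms(1,3) that unfolding uniformizer_def by blast
  then have "\<exists>k. ?P k" using assms(2) by blast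
  from LeastI_ex[OF this] obtain s u where s: "s \<in> S" "r_unit V u" "s = u * t ^ (LEAST k. ?P k)"
    by blast
  have "x / s \<in> V" if x: "x \<in> S" for x
  proof -
    obtain k w where k: "r_unit V w" "x = w * t ^ k" using ex[OF x] by blast
    then have le: "(LEAST k. ?P k) \<le> k" using x by (intro Least_le) blast
    have "x / s = w * inverse u * t ^ (k - (LEAST k. ?P k))"
      using le assms(1) unfolding k(2) s(3) uniformizer_def
      by (simp add: power_diff divide_inverse mult_ac)
    then show ?thesis using k s assms(1) M_sub_V unfolding r_unit_def uniformizer_def
      by (auto intro!: V_intros)
  qed
  then show ?thesis using s by blast
qed

text \<open>From left to right, \<open>ACCP_uniformizer\<close> is applied to \<open>V\<close>
  itself. From right to left, an ideal is generated by a nonzero element of least exponent.\<close>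

lemma DVR_iff: "is_DVR V \<longleftrightarrow> (\<exists>t. uniformizer t)"
proof
  assume dvr: "is_DVR V"
  then have "M \<noteq> {0}" using M_iff unfolding is_DVR_def is_field_set_def by auto
  then show "\<exists>t. uniformizer t"
    using ACCP_uniformizer[of V] noetherian_ACCP[OF _ V_subring] dvr M_sub_V
    unfolding is_DVR_def local_dom_def by blast
next
  assume "\<exists>t. uniformizer t"
  then obtain t where t: "uniformizer t" by blast
  have "is_PID V" unfolding is_PID_def
  proof (intro allI impI)
    fix I assume I: "r_ideal V I"
    show "r_principal V I"
    proof (cases "I = {0}")
      case True
      then show ?thesis unfolding r_principal_def using V_intros(1) by (intro bexI[of _ 0]) auto
    next
      case False
      then have "I - {0} \<noteq> {}" "I - {0} \<subseteq> V - {0}" using I unfolding r_ideal_def by auto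
      from uniformizer_min[OF t this] obtain s
        where s: "s \<in> I" "s \<noteq> 0" "\<And>x. x \<in> I - {0} \<Longrightarrow> x / s \<in> V" by blast
      have "I = {r * s | r. r \<in> V}"
      proof
        show "{r * s | r. r \<in> V} \<subseteq> I" using s I unfolding r_ideal_def by blast
        have "x / s \<in> V \<and> x = (x / s) * s" if "x \<in> I" for x
          using s that V_intros(1) by (cases "x = 0") auto
        then show "I \<subseteq> {r * s | r. r \<in> V}" by blast
      qed
      then show ?thesis using s I unfolding r_principal_def r_ideal_def by blast
    qed
  qed
  moreover have "\<not> is_field_set V"
    using t M_iff unfolding uniformizer_def is_field_set_def by blast
  ultimately show "is_DVR V"
    unfolding is_DVR_def local_dom_def using PID_noetherian V_subring V_quasilocal by blast
qed

end

section \<open>The construction \<open>D + M\<close>\<close>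

locale D_plus_M = valuation_ring +
  fixes K D R :: "'a set"
  assumes M_nonzero: "M \<noteq> {0}"
    and K_subfield: "is_subfield K" and K_sub_V: "K \<subseteq> V"
    and V_eq: "V = set_plus K M"
    and D_subring: "is_subring D" and D_sub_K: "D \<subseteq> K"
    and R_eq: "R = set_plus D M"
begin

lemma K_subring: "is_subring K" and K_inverse: "x \<in> K \<Longrightarrow> x \<noteq> 0 \<Longrightarrow> inverse x \<in> K"
  using K_subfield unfolding is_subfield_def is_field_set_def by auto

lemmas D_intros = subringD[OF D_subring] subring_power[OF D_subring]
lemmas K_intros = subringD[OF K_subring] subring_power[OF K_subring]

text \<open>Nonzero elements of \<open>K\<close> are units of \<open>V\<close>. Hence the sum
  \<open>K + M\<close> is direct and residues in \<open>K\<close> are unique.\<close>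

lemma K_Int_M: "x \<in> K \<Longrightarrow> x \<in> M \<Longrightarrow> x = 0"
  using K_inverse K_sub_V M_iff by blast

lemma V_cases:
  assumes "x \<in> V"
  obtains k m where "x = k + m" "k \<in> K" "m \<in> M"
  using assms unfolding V_eq set_plus_def by blast

lemma R_cases:
  assumes "x \<in> R"
  obtains d m where "x = d + m" "d \<in> D" "m \<in> M"
  using assms unfolding R_eq set_plus_def by blast

lemma R_I: "d \<in> D \<Longrightarrow> m \<in> M \<Longrightarrow> d + m \<in> R"
  unfolding R_eq set_plus_def by blast

lemma M_sub_R: "M \<subseteq> R"
  using R_I[of 0] D_intros(1) by auto

lemma D_sub_R: "D \<subseteq> R"
  using R_I[of _ 0] M_zero by auto

lemma R_sub_V: "R \<subseteq> V"
  using R_cases D_sub_K K_sub_V M_sub_V V_intros(3) by (metis subsetD subsetI)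

text \<open>The way in which membership in \<open>D\<close> is obtained throughout: an element of
  \<open>K\<close> is first shown to lie in \<open>R\<close>.\<close>

lemma R_Int_K:
  assumes "x \<in> R" "x \<in> K"
  shows "x \<in> D"
proof -
  obtain d m where x: "x = d + m" "d \<in> D" "m \<in> M" using R_cases[OF assms(1)] .
  then have "m = x - d" by simp
  then have "m \<in> K" using K_intros(6) assms(2) x D_sub_K by blast
  then have "m = 0" using K_Int_M x by blast
  then show ?thesis using x by simp
qed

lemma R_subring: "is_subring R"
  unfolding is_subring_def
proof (intro conjI ballI)
  show "0 \<in> R" "1 \<in> R" using D_sub_R D_intros(1,2) by auto
next
  fix x y assume "x \<in> R" "y \<in> R"
  then obtain d m e n where x: "x = d + m" "d \<in> D" "m \<in> M" "y = e + n" "e \<in> D" "n \<in> M"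
    using R_cases by metis
  have dV: "d \<in> V" "m \<in> V" using x D_sub_K K_sub_V M_sub_V by auto
  have eV: "e \<in> V" using x D_sub_K K_sub_V by auto
  have "(d + e) + (m + n) \<in> R" using x by (intro R_I D_intros M_add)
  then show "x + y \<in> R" using x by (simp add: algebra_simps)
  have "d * e + ((d + m) * n + m * e) \<in> R"
    using x dV eV by (intro R_I D_intros M_add M_mult M_mult_right V_intros)
  then show "x * y \<in> R" using x by (simp add: algebra_simps)
next
  fix x assume "x \<in> R"
  then obtain d m where "x = d + m" "d \<in> D" "m \<in> M" using R_cases by metis
  then have "- d + - m \<in> R" by (intro R_I D_intros M_uminus)
  then show "- x \<in> R" using \<open>x = d + m\<close> by simp
qed

lemmas R_intros = subringD[OF R_subring] subring_power[OF R_subring]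

lemma M_ideal_R: "r_ideal R M"
  unfolding r_ideal_def using M_sub_R M_zero M_add M_mult R_sub_V by auto

lemma obtain_M:
  obtains m where "m \<in> M" "m \<noteq> 0"
  using M_nonzero M_zero by blast

lemma inverse_in_R:
  assumes "is_field_set D" "r \<in> R" "r \<notin> M"
  shows "inverse r \<in> R"
proof -
  obtain d m where r: "r = d + m" "d \<in> D" "m \<in> M" using R_cases[OF assms(2)] .
  have r0: "r \<noteq> 0" using assms(3) M_zero by auto
  have d0: "d \<noteq> 0" using r assms(3) by auto
  have id: "inverse d \<in> D" using assms(1) r(2) d0 unfolding is_field_set_def by blast
  have "inverse r \<in> V" using assms(2,3) R_sub_V M_iff by blast
  \<comment> \<open>The inverse of \<open>r = d + m\<close> exists in \<open>V\<close> and differs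
    from \<open>inverse d \<in> D\<close> by \<open>inverse d * inverse r * m\<close>, which lies in
    \<open>M\<close>.\<close>
  then have "- (inverse d * inverse r) * m \<in> M"
    using id D_sub_K K_sub_V r(3) by (intro M_mult V_intros) auto
  with id have "inverse d + - (inverse d * inverse r) * m \<in> R" by (rule R_I)
  moreover have "inverse d + - (inverse d * inverse r) * m = inverse r"
  proof -
    have "inverse d = inverse d * inverse r * (d + m)" using r(1) r0 by simp
    then have "inverse d + - (inverse d * inverse r) * m = inverse d * inverse r * d"
      by (simp add: algebra_simps)
    then show ?thesis using d0 by simp
  qed
  ultimately show ?thesis by simp
qed

lemma R_quasilocal: "is_field_set D \<Longrightarrow> quasilocal R"
  using R_subring M_ideal_R M_one by (rule quasilocalI) (use inverse_in_R in blast)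

lemma unit_R_iff: "is_field_set D \<Longrightarrow> r_unit R u \<longleftrightarrow> u \<in> R \<and> u \<notin> M"
  using inverse_in_R R_sub_V M_iff M_zero unfolding r_unit_def by blast

lemma unit_R_unit_V: "r_unit R u \<Longrightarrow> r_unit V u"
  using R_sub_V unfolding r_unit_def by blast

section \<open>Necessary conditions on \<open>V\<close>, \<open>D\<close> and
  \<open>K\<close>\<close>

lemma ACCP_D_field:
  assumes "ACCP R"
  shows "is_field_set D"
  unfolding is_field_set_def
proof (intro ballI impI)
  fix d assume d: "d \<in> D" "d \<noteq> 0"
  obtain m where m: "m \<in> M" "m \<noteq> 0" using obtain_M .
  \<comment> \<open>These stay in \<open>M\<close> because \<open>inverse d\<close> lies in
    \<open>K\<close>, and all consecutive ratios equal \<open>d\<close>; a single non-strict step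
    therefore puts \<open>inverse d\<close> into \<open>R\<close>.\<close>
  let ?x = "\<lambda>n. m / d ^ n"
  have id: "inverse d \<in> K" using d D_sub_K K_inverse by blast
  have "inverse d ^ n * m \<in> M" for n using m id K_sub_V by (intro M_mult V_intros) auto
  then have x: "?x n \<in> R \<and> ?x n \<noteq> 0" for n using M_sub_R m d by (auto simp: field_simps)
  have q: "?x n / ?x (Suc n) = d" "?x (Suc n) / ?x n = inverse d" for n
    using m d by (auto simp: field_simps)
  have "d \<in> R" using d D_sub_R by blast
  have "inverse d \<in> R"
  proof -
    have "?x n \<in> R \<and> ?x n \<noteq> 0 \<and> ?x n / ?x (Suc n) \<in> R" for n
      unfolding q using x \<open>d \<in> R\<close> by blast
    from ACCP_D[where x="?x", OF assms this] show ?thesis unfolding q by blast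
  qed
  then show "inverse d \<in> D" using R_Int_K id by blast
qed

lemma ACCP_DVR: "ACCP R \<Longrightarrow> is_DVR V"
  using DVR_iff ACCP_uniformizer[OF _ M_sub_R R_sub_V M_nonzero] by blast

lemma fspan_sub_K:
  assumes "W \<subseteq> K"
  shows "fspan D W \<subseteq> K"
proof -
  have "submod D K" unfolding submod_def using K_intros D_sub_K by auto
  then show ?thesis using assms by (rule fspan_least)
qed

lemma ideal_of_subspace:
  assumes "m \<in> M" "submod D W" "W \<subseteq> K"
  shows "r_ideal R {m * (w + n) | w n. w \<in> W \<and> n \<in> M}"
  unfolding r_ideal_def
proof (intro conjI ballI)
  show "{m * (w + n) | w n. w \<in> W \<and> n \<in> M} \<subseteq> R"
  proof clarify
    fix w n assume "w \<in> W" "n \<in> M"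
    then have "m * (w + n) \<in> M"
      using assms K_sub_V M_sub_V by (intro M_mult_right V_intros) auto
    then show "m * (w + n) \<in> R" using M_sub_R by blast
  qed
  show "0 \<in> {m * (w + n) | w n. w \<in> W \<and> n \<in> M}" using submodD(1)[OF assms(2)] M_zero by force
next
  fix x y assume "x \<in> {m * (w + n) | w n. w \<in> W \<and> n \<in> M}" "y \<in> {m * (w + n) | w n. w \<in> W \<and> n \<in> M}"
  then obtain w n w' n' where *: "x = m * (w + n)" "y = m * (w' + n')" "w \<in> W" "w' \<in> W" "n \<in> M" "n' \<in> M"
    by blast
  then have "x + y = m * ((w + w') + (n + n'))" "w + w' \<in> W" "n + n' \<in> M"
    using submodD(2)[OF assms(2)] M_add by (auto simp: algebra_simps)
  then show "x + y \<in> {m * (w + n) | w n. w \<in> W \<and> n \<in> M}" by blast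
next
  fix r x assume "r \<in> R" "x \<in> {m * (w + n) | w n. w \<in> W \<and> n \<in> M}"
  then obtain w n where *: "x = m * (w + n)" "w \<in> W" "n \<in> M" by blast
  obtain d l where r: "r = d + l" "d \<in> D" "l \<in> M" using R_cases[OF \<open>r \<in> R\<close>] .
  have "r \<in> V" "w \<in> V" using \<open>r \<in> R\<close> R_sub_V * assms(3) K_sub_V by auto
  \<comment> \<open>In \<open>(d + l) * (w + n)\<close> only \<open>d * w\<close> survives modulo
    \<open>M\<close>, so closure of \<open>W\<close> under \<open>D\<close> suffices.\<close>
  then have "r * n + l * w \<in> M" using * r by (intro M_add M_mult M_mult_right)
  moreover have "d * w \<in> W" using submodD(3)[OF assms(2)] r * by blast
  moreover have "r * x = m * (d * w + (r * n + l * w))" using * r by (simp add: algebra_simps)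
  ultimately show "r * x \<in> {m * (w + n) | w n. w \<in> W \<and> n \<in> M}" by blast
qed

text \<open>In infinite dimension, finite subsets of \<open>K\<close> with strictly growing spans
  give strictly growing ideals \<open>m (W + M)\<close>: cancelling \<open>m\<close> and using that
  \<open>K\<close> and \<open>M\<close> meet in \<open>0\<close> recovers \<open>W\<close>.\<close>

lemma noetherian_fin_dim:
  assumes "noetherian R"
  shows "fin_dim D K"
proof (rule ccontr)
  assume "\<not> fin_dim D K"
  then have neg: "\<exists>k\<in>K. k \<notin> fspan D B" if "finite B" "B \<subseteq> K" for B
    using that unfolding fin_dim_iff[OF D_subring] by blast
  have "\<exists>B. \<forall>n. (finite (B n) \<and> B n \<subseteq> K) \<and> (B n \<subseteq> B (Suc n) \<and> \<not> B (Suc n) \<subseteq> fspan D (B n))"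
  proof (rule dependent_nat_choice[where P="\<lambda>_ B. finite B \<and> B \<subseteq> K"
        and Q="\<lambda>_ B C. B \<subseteq> C \<and> \<not> C \<subseteq> fspan D B"])
    fix B assume "finite B \<and> B \<subseteq> K"
    then show "\<exists>C. (finite C \<and> C \<subseteq> K) \<and> B \<subseteq> C \<and> \<not> C \<subseteq> fspan D B"
      using neg[of B] by (metis finite_insert insert_subset subset_insertI)
  qed blast
  then obtain B where B: "\<And>n. B n \<subseteq> K" "\<And>n. B n \<subseteq> B (Suc n)" "\<And>n. \<not> B (Suc n) \<subseteq> fspan D (B n)"
    by blast
  obtain m where m: "m \<in> M" "m \<noteq> 0" using obtain_M .
  let ?I = "\<lambda>i. {m * (w + n) | w n. w \<in> fspan D (B i) \<and> n \<in> M}"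
  have "\<forall>i. r_ideal R (?I i) \<and> ?I i \<subseteq> ?I (Suc i)"
    using ideal_of_subspace[OF m(1) submod_fspan fspan_sub_K[OF B(1)]] fspan_mono[OF B(2)]
    by blast
  from assms[unfolded noetherian_def, rule_format, of ?I, OF this[rule_format]]
  obtain N where N: "\<forall>n\<ge>N. ?I n = ?I N" by blast
  have eq: "?I (Suc N) = ?I N" by (rule N[rule_format]) simp
  obtain b where b: "b \<in> B (Suc N)" "b \<notin> fspan D (B N)" using B(3) by blast
  then have "m * (b + 0) \<in> ?I (Suc N)" using fspan_superset[of "B (Suc N)" D] M_zero by blast
  then have "m * (b + 0) \<in> ?I N" using eq by simp
  then obtain w n where w: "m * (b + 0) = m * (w + n)" "w \<in> fspan D (B N)" "n \<in> M" by blast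
  have "b - w = n" using w(1) m(2) by simp
  moreover have "b - w \<in> K" using b(1) w(2) B(1) fspan_sub_K[OF B(1)] K_intros(6) by blast
  ultimately have "n = 0" using K_Int_M w(3) by blast
  then show False using \<open>b - w = n\<close> b(2) w(2) by simp
qed

lemma AV_root_ext:
  assumes "AV_domain R" "is_field_set D"
  shows "root_ext D K"
  unfolding root_ext_def
proof
  fix k assume k: "k \<in> K"
  obtain m where m: "m \<in> M" "m \<noteq> 0" using obtain_M .
  show "\<exists>n>0. k ^ n \<in> D"
  proof (cases "k = 0")
    case True
    then show ?thesis using D_intros(1) by (intro exI[of _ 1]) auto
  next
    case False
    \<comment> \<open>The factor \<open>m\<close> brings \<open>k\<close> into \<open>R\<close>; it
      cancels when powers are compared, leaving \<open>k ^ n\<close> or its inverse in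
      \<open>R\<close>.\<close>
    have "k * m \<in> R" "m \<in> R" using M_mult m k K_sub_V M_sub_R by auto
    then obtain n where n: "n > 0" "r_dvd R ((k * m) ^ n) (m ^ n) \<or> r_dvd R (m ^ n) ((k * m) ^ n)"
      using assms(1) m False unfolding AV_domain_def by (metis mult_eq_0_iff)
    then obtain c where c: "c \<in> R" "m ^ n = (k * m) ^ n * c \<or> (k * m) ^ n = m ^ n * c"
      unfolding r_dvd_def by blast
    have "inverse (k ^ n) = c \<or> k ^ n = c"
      using c(2) m False by (auto simp: power_mult_distrib field_simps)
    moreover have "k ^ n \<in> K" "inverse (k ^ n) \<in> K" using k False K_intros(7) K_inverse by auto
    ultimately have "inverse (k ^ n) \<in> D \<or> k ^ n \<in> D" using R_Int_K c(1) by blast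
    then have "k ^ n \<in> D" using assms(2) False unfolding is_field_set_def
      by (metis inverse_inverse_eq inverse_nonzero_iff_nonzero power_not_zero)
    then show ?thesis using n by blast
  qed
qed

text \<open>Applying the API condition to all \<open>k * m\<close> at once yields one exponent for
  the whole of \<open>K\<close>. The generator \<open>x\<close> turns out to be \<open>m ^ n\<close>
  times a unit \<open>v\<close> of \<open>R\<close>, so dividing \<open>(k * m) ^ n\<close> by
  \<open>m ^ n\<close> leaves \<open>k ^ n\<close> in \<open>R\<close>.\<close>

lemma API_bounded_root_ext:
  assumes "API_domain R" "is_field_set D"
  shows "bounded_root_ext D K"
proof -
  obtain m where m: "m \<in> M" "m \<noteq> 0" using obtain_M .
  let ?S = "{k * m | k. k \<in> K \<and> k \<noteq> 0}"
  have "1 * m \<in> ?S" using K_intros(2) by force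
  then have "?S \<noteq> {}" by blast
  moreover have "?S \<subseteq> R - {0}" using m M_mult K_sub_V M_sub_R by auto
  ultimately have "\<exists>n>0. r_principal R (r_gen R ((\<lambda>d. d ^ n) ` ?S))"
    by (rule assms(1)[unfolded API_domain_def, rule_format])
  then obtain n where n: "n > 0" "r_principal R (r_gen R ((\<lambda>d. d ^ n) ` ?S))" by blast
  let ?J = "r_gen R ((\<lambda>d. d ^ n) ` ?S)"
  obtain x where x: "?J = {r * x | r. r \<in> R}" using n(2) unfolding r_principal_def by blast
  have gen: "\<exists>r\<in>R. (k * m) ^ n = r * x" if "k \<in> K" "k \<noteq> 0" for k
  proof -
    have "(k * m) ^ n \<in> ?J" using r_gen_superset[of "(\<lambda>d. d ^ n) ` ?S" R] that by blast
    then show ?thesis unfolding x by blast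
  qed
  have mn: "m ^ n \<in> M" using M_mult[of "m ^ (n - 1)" m] m n(1) M_sub_V V_intros(7)
    by (cases n) (auto simp: mult.commute)
  \<comment> \<open>This \<open>V\<close>-ideal lies in \<open>M\<close>, so it is also an ideal of
    \<open>R\<close>; it bounds \<open>?J\<close> from above and shows that \<open>x\<close> is a
    \<open>V\<close>-multiple of \<open>m ^ n\<close>.\<close>
  let ?I = "{r * m ^ n | r. r \<in> V}"
  have "r_ideal V ?I" using principal_ideal[OF V_subring] mn M_sub_V by blast
  moreover have "?I \<subseteq> R" using M_mult mn M_sub_R by blast
  ultimately have "r_ideal R ?I" using R_sub_V unfolding r_ideal_def by blast
  moreover have "(\<lambda>d. d ^ n) ` ?S \<subseteq> ?I"
  proof clarify
    fix k assume "k \<in> K"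
    then have "k ^ n \<in> V" using K_sub_V V_intros(7) by blast
    then show "\<exists>r. (k * m) ^ n = r * m ^ n \<and> r \<in> V" unfolding power_mult_distrib by blast
  qed
  ultimately have "?J \<subseteq> ?I" by (rule r_gen_least)
  moreover have "1 * x \<in> ?J" unfolding x using R_intros(2) by blast
  ultimately obtain v where v: "x = v * m ^ n" "v \<in> V" by auto
  \<comment> \<open>The generator with \<open>k = 1\<close> makes \<open>m ^ n\<close> an
    \<open>R\<close>-multiple of \<open>x\<close>, so \<open>v\<close> is the inverse of an element
    of \<open>R\<close> outside \<open>M\<close>.\<close>
  obtain r0 where r0: "r0 \<in> R" "m ^ n = r0 * x" using gen[of 1] K_intros(2) by auto
  have one: "r0 * v = 1" using r0(2) v(1) m by simp
  then have v_eq: "inverse r0 = v" by (rule inverse_unique)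
  have "r0 \<notin> M" using one v(2) M_mult_right[of r0 v] M_one by auto
  then have vR: "v \<in> R" using inverse_in_R[OF assms(2) r0(1)] v_eq by simp
  have "k ^ n \<in> D" if k: "k \<in> K" for k
  proof (cases "k = 0")
    case True
    then show ?thesis using n(1) D_intros(1) by (simp add: power_0_left)
  next
    case False
    obtain r where r: "r \<in> R" "(k * m) ^ n = r * x" using gen[OF k False] by blast
    have "k ^ n = r * v" using r(2) v(1) m by (simp add: power_mult_distrib)
    then have "k ^ n \<in> R" using r(1) vR R_intros(4) by simp
    then show ?thesis using R_Int_K K_intros(7) k by blast
  qed
  then show ?thesis using n(1) unfolding bounded_root_ext_def by blast
qed

section \<open>Sufficient conditions for the AV and API properties\<close>

text \<open>Reduction modulo \<open>M\<close> is multiplicative, so \<open>x ^ n\<close> has residue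
  \<open>k ^ n\<close>. Restricting the hypothesis to residues of \<open>x\<close> lets
  \<open>n\<close> depend on \<open>x\<close>, as an unbounded root extension requires.\<close>

lemma V_power_in_R:
  assumes "\<And>k. k \<in> K \<Longrightarrow> x - k \<in> M \<Longrightarrow> k ^ n \<in> D" "x \<in> V"
  shows "x ^ n \<in> R"
proof -
  obtain k m where x: "x = k + m" "k \<in> K" "m \<in> M" using V_cases[OF assms(2)] .
  have kV: "k \<in> V" "m \<in> V" using x K_sub_V M_sub_V by auto
  have "x ^ i - k ^ i \<in> M" for i
  proof (induction i)
    case (Suc i)
    have "x * (x ^ i - k ^ i) + k ^ i * m \<in> M"
      using Suc assms(2) x(3) kV by (intro M_add M_mult V_intros)
    then show ?case using x(1) by (simp add: algebra_simps)
  qed (simp add: M_zero)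
  then have "k ^ n + (x ^ n - k ^ n) \<in> R" using x assms(1) by (intro R_I) auto
  then show ?thesis by simp
qed

lemma root_ext_V:
  assumes "root_ext D K" "x \<in> V"
  shows "\<exists>n>0. x ^ n \<in> R"
proof -
  obtain k m where x: "x = k + m" "k \<in> K" "m \<in> M" using V_cases[OF assms(2)] .
  obtain n where n: "n > 0" "k ^ n \<in> D" using assms(1) x(2) unfolding root_ext_def by blast
  \<comment> \<open>Uniqueness of the residue: the exponent chosen for \<open>k\<close> serves every
    admissible \<open>l\<close>.\<close>
  have "l = k" if l: "l \<in> K" "x - l \<in> M" for l
  proof -
    have "(x - l) - m \<in> M" using M_diff l(2) x(3) by blast
    moreover have "(x - l) - m = k - l" using x(1) by simp
    ultimately show ?thesis using K_Int_M[of "k - l"] K_intros(6) l(1) x(2) by auto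
  qed
  then have "x ^ n \<in> R" using V_power_in_R[of x n] n(2) assms(2) by blast
  then show ?thesis using n(1) by blast
qed

text \<open>One of \<open>b / a\<close> and \<open>a / b\<close> lies in \<open>V\<close>, and a
  power of it falls into \<open>R\<close>.\<close>

lemma root_ext_AV:
  assumes "root_ext D K"
  shows "AV_domain R"
proof -
  have dvd: "\<exists>n>0. r_dvd R (a ^ n) (b ^ n)" if ab: "a \<noteq> 0" "b / a \<in> V" for a b
  proof -
    obtain n where n: "n > 0" "(b / a) ^ n \<in> R" using root_ext_V[OF assms ab(2)] by blast
    moreover have "b ^ n = a ^ n * (b / a) ^ n" using ab(1) by (simp add: power_divide)
    ultimately show ?thesis unfolding r_dvd_def by blast
  qed
  show ?thesis unfolding AV_domain_def
  proof (intro ballI impI)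
    fix a b :: 'a assume "a \<noteq> 0" "b \<noteq> 0"
    then show "\<exists>n>0. r_dvd R (a ^ n) (b ^ n) \<or> r_dvd R (b ^ n) (a ^ n)"
      using dvd[of a b] dvd[of b a] V_total[of "b / a"] by auto
  qed
qed

text \<open>For \<open>s\<close> of least value in \<open>S\<close>, every \<open>x / s\<close> lies
  in \<open>V\<close>, and its power with the common exponent lies in \<open>R\<close>. So
  \<open>s ^ n\<close> generates.\<close>

lemma bounded_root_ext_API:
  assumes "bounded_root_ext D K" "is_DVR V"
  shows "API_domain R"
proof -
  obtain n where n: "n > 0" "\<And>k. k \<in> K \<Longrightarrow> k ^ n \<in> D"
    using assms(1) unfolding bounded_root_ext_def by blast
  obtain t where t: "uniformizer t" using assms(2) DVR_iff by blast
  have "\<exists>n>0. r_principal R (r_gen R ((\<lambda>d. d ^ n) ` S))" if S: "S \<noteq> {}" "S \<subseteq> R - {0}" for S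
  proof -
    have "S \<subseteq> V - {0}" using S(2) R_sub_V by blast
    then obtain s where s: "s \<in> S" "\<And>x. x \<in> S \<Longrightarrow> x / s \<in> V" using uniformizer_min[OF t S(1)] by blast
    have s0: "s \<noteq> 0" and sR: "s ^ n \<in> R" using s(1) S(2) R_intros(7) by auto
    have "r_gen R ((\<lambda>d. d ^ n) ` S) = {r * s ^ n | r. r \<in> R}"
    proof
      have "\<exists>r\<in>R. x ^ n = r * s ^ n" if "x \<in> S" for x
        using V_power_in_R[of "x / s" n] s(2)[OF that] n(2) s0
        by (intro bexI[of _ "(x / s) ^ n"]) (auto simp: power_divide)
      then have "(\<lambda>d. d ^ n) ` S \<subseteq> {r * s ^ n | r. r \<in> R}" by blast
      with principal_ideal[OF R_subring sR] show "r_gen R ((\<lambda>d. d ^ n) ` S) \<subseteq> {r * s ^ n | r. r \<in> R}"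
        by (rule r_gen_least)
      show "{r * s ^ n | r. r \<in> R} \<subseteq> r_gen R ((\<lambda>d. d ^ n) ` S)"
        unfolding r_gen_def using s(1) by (auto simp: r_ideal_def)
    qed
    then have "r_principal R (r_gen R ((\<lambda>d. d ^ n) ` S))"
      using sR unfolding r_principal_def by blast
    then show ?thesis using n(1) by (intro exI[of _ n]) simp
  qed
  then show ?thesis by (simp add: API_domain_def)
qed

section \<open>Finite dimension and the Noetherian property\<close>

text \<open>The quotient of \<open>V\<close> by \<open>t ^ k V\<close> is finite-dimensional over
  \<open>D\<close>: each layer between consecutive powers of \<open>t\<close> is a copy of
  \<open>K\<close>, so a step adds a spanning set of \<open>K\<close> times
  \<open>t ^ k\<close>.\<close>

lemma V_mod_power_finite:
  assumes t: "uniformizer t" and "fin_dim D K"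
  shows "\<exists>G. finite G \<and> V \<subseteq> fspan D ({v * t ^ k | v. v \<in> V} \<union> G)"
proof (induction k)
  case 0
  have "V \<subseteq> fspan D ({v * t ^ 0 | v. v \<in> V} \<union> {})" using fspan_superset[of V D] by simp
  then show ?case by blast
next
  case (Suc k)
  then obtain G where G: "finite G" "V \<subseteq> fspan D ({v * t ^ k | v. v \<in> V} \<union> G)" by blast
  obtain B where B: "finite B" "B \<subseteq> K" "K \<subseteq> fspan D B"
    using assms(2) unfolding fin_dim_iff[OF D_subring] by blast
  let ?T = "{v * t ^ Suc k | v. v \<in> V}"
  let ?X = "fspan D (?T \<union> (G \<union> (\<lambda>b. b * t ^ k) ` B))"
  have sub: "submod D ?X" by (rule submod_fspan)
  have sup: "?T \<union> (G \<union> (\<lambda>b. b * t ^ k) ` B) \<subseteq> ?X" by (rule fspan_superset)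
  have "submod D {c. c * t ^ k \<in> ?X}"
    using sub unfolding submod_def by (auto simp: distrib_right mult.assoc)
  moreover have "B \<subseteq> {c. c * t ^ k \<in> ?X}" using sup by blast
  ultimately have K: "K \<subseteq> {c. c * t ^ k \<in> ?X}" using fspan_least B(3) by blast
  have "v * t ^ k \<in> ?X" if v: "v \<in> V" for v
  proof -
    obtain c m where c: "v = c + m" "c \<in> K" "m \<in> M" using V_cases[OF v] .
    \<comment> \<open>\<open>M\<close> is generated by \<open>t\<close>: a zero exponent would make
      \<open>m\<close> a unit.\<close>
    have "m \<in> {w * t | w. w \<in> V}"
    proof (cases "m = 0")
      case True
      have "0 * t \<in> {w * t | w. w \<in> V}" using V_intros(1) by blast
      with True show ?thesis by simp
    next
      case False
      then obtain j u where u: "r_unit V u" "m = u * t ^ j"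
        using t c(3) M_sub_V unfolding uniformizer_def by blast
      then obtain i where i: "j = Suc i" using c(3) unit_iff by (cases j) auto
      have "u * t ^ i \<in> V" using u t M_sub_V unfolding r_unit_def uniformizer_def
        by (auto intro!: V_intros)
      moreover have "m = u * t ^ i * t" using u i by simp
      ultimately show ?thesis by blast
    qed
    then obtain w where "m = w * t" "w \<in> V" by blast
    then have "m * t ^ k = w * t ^ Suc k" "w * t ^ Suc k \<in> ?T" by (auto simp: mult_ac)
    then have "m * t ^ k \<in> ?T" by (simp only:)
    then have "m * t ^ k \<in> ?X" using sup by blast
    moreover have "c * t ^ k \<in> ?X" using K c(2) by blast
    ultimately show ?thesis using submodD(2)[OF sub] c(1) by (simp add: distrib_right)
  qed
  then have "{v * t ^ k | v. v \<in> V} \<union> G \<subseteq> ?X" using sup by blast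
  then have "fspan D ({v * t ^ k | v. v \<in> V} \<union> G) \<subseteq> ?X" by (rule fspan_least[OF sub])
  then have "V \<subseteq> ?X" using G(2) by blast
  then show ?case using G(1) B(1) by (intro exI[of _ "G \<union> (\<lambda>b. b * t ^ k) ` B"]) auto
qed

text \<open>A nonzero ideal of \<open>R\<close> contains \<open>x M = t ^ (k + 1) V\<close> for some \<open>x\<close>, and \<open>V / t ^ (k + 1) V\<close>
  has finite dimension over \<open>D\<close>.\<close>
lemma fin_dim_noetherian:
  assumes "is_DVR V" "is_field_set D" "fin_dim D K"
  shows "noetherian R"
  unfolding noetherian_def
proof (intro allI impI)
  fix I :: "nat \<Rightarrow> 'a set"
  assume I: "\<forall>n. r_ideal R (I n) \<and> I n \<subseteq> I (Suc n)"
  have mono: "I k \<subseteq> I l" if "k \<le> l" for k l using lift_Suc_mono_le[of I] I that by blast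
  have sub: "submod D (I n)" for n
  proof -
    have "r_ideal R (I n)" using I by blast
    then show ?thesis using D_sub_R unfolding r_ideal_def submod_def by blast
  qed
  obtain t where t: "uniformizer t" using assms(1) DVR_iff by blast
  show "\<exists>N. \<forall>n\<ge>N. I n = I N"
  proof (cases "\<forall>n. I n = {0}")
    case False
    then obtain N x where x: "x \<in> I N" "x \<noteq> 0" using submodD(1)[OF sub] by blast
    then have "x \<in> V" using I R_sub_V unfolding r_ideal_def by blast
    then obtain k u where u: "r_unit V u" "x = u * t ^ k" using t x unfolding uniformizer_def by blast
    let ?Z = "{v * t ^ Suc k | v. v \<in> V}"
    have tV: "t \<in> M" using t unfolding uniformizer_def by blast
    have Z: "?Z \<subseteq> I N"
    proof clarify
      fix v assume v: "v \<in> V"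
      \<comment> \<open>The extra factor \<open>t\<close> moves the multiplier from \<open>V\<close>
        into \<open>M\<close>, hence into \<open>R\<close>; this is why the exponent is
        \<open>Suc k\<close>.\<close>
      have "v * inverse u * t \<in> M"
        using v u tV unfolding r_unit_def by (intro M_mult V_intros) auto
      then have "v * inverse u * t * x \<in> I N" using I x(1) M_sub_R unfolding r_ideal_def by blast
      moreover have "v * inverse u * t * x = v * t ^ Suc k"
        using u unfolding r_unit_def by (simp add: field_simps)
      ultimately show "v * t ^ Suc k \<in> I N" by simp
    qed
    have "t ^ Suc k \<in> V" using tV M_sub_V V_intros(7) by blast
    then have "r_ideal V ?Z" by (rule principal_ideal[OF V_subring])
    then have subZ: "submod D ?Z" using D_sub_K K_sub_V unfolding submod_def r_ideal_def by blast
    obtain G where G: "finite G" "V \<subseteq> fspan D (?Z \<union> G)"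
      using V_mod_power_finite[OF t assms(3)] by blast
    have Df: "is_subfield D" using D_subring assms(2) unfolding is_subfield_def by blast
    \<comment> \<open>The chain is shifted by \<open>N\<close> so that all its members contain
      \<open>?Z\<close>.\<close>
    have "\<exists>N'. \<forall>n\<ge>N'. I (n + N) = I (N' + N)"
    proof (rule submod_chain_stationary[OF Df G(1) subZ])
      show "I (n + N) \<subseteq> I (Suc n + N)" for n using I by simp
      show "?Z \<subseteq> I (n + N)" for n using Z mono[of N "n + N"] by auto
      have "I m \<subseteq> R" for m using I unfolding r_ideal_def by blast
      then show "I (n + N) \<subseteq> fspan D (?Z \<union> G)" for n using R_sub_V G(2) by (meson subset_trans)
    qed (rule sub)
    then obtain N' where N': "\<And>n. n \<ge> N' \<Longrightarrow> I (n + N) = I (N' + N)" by blast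
    have "I n = I (N' + N)" if "n \<ge> N' + N" for n
      using N'[of "n - N"] that by simp
    then show ?thesis by blast
  qed auto
qed

section \<open>Almost uniformizing parameters and rational value groups\<close>

text \<open>A power of some nonzero \<open>m \<in> M\<close> is a unit times a positive power of
  \<open>a\<close>, so \<open>a\<close> is a nonzero element of \<open>M\<close>. A nonzero
  \<open>d \<in> D\<close> without inverse in \<open>D\<close> would have a power divisible by
  \<open>a\<close>, hence in \<open>M\<close>, although it lies in \<open>K\<close>.\<close>

lemma RAV_param:
  assumes "RAV_domain R"
  obtains a where "almost_unif_param R a" "a \<in> M" "a \<noteq> 0" "is_field_set D"
proof -
  obtain a where a: "almost_unif_param R a" using assms unfolding RAV_domain_def by blast
  obtain m where m: "m \<in> M" "m \<noteq> 0" using obtain_M .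
  have "\<not> r_unit R m" using m M_iff R_sub_V unfolding r_unit_def by blast
  then obtain i j u where u: "r_unit R u" "m ^ i = u * a ^ j" "i > 0" "j > 0"
    using a m M_sub_R unfolding almost_unif_param_def by blast
  have a0: "a \<noteq> 0" using u m by (auto simp: power_0_left)
  have aV: "a \<in> V" using a R_sub_V unfolding almost_unif_param_def by blast
  have "inverse a \<notin> V"
  proof
    assume "inverse a \<in> V"
    then have "r_unit V a" using aV a0 unfolding r_unit_def by blast
    then have "r_unit V (u * a ^ j)" using unit_R_unit_V[OF u(1)] unit_mult unit_power by blast
    then have "inverse (m ^ i) \<in> V" unfolding u(2)[symmetric] r_unit_def by blast
    then have "inverse m \<in> V" using power_in_V[OF u(3), of "inverse m"] by (simp add: power_inverse)
    then show False using m M_iff by blast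
  qed
  then have aM: "a \<in> M" using aV M_iff by blast
  have "inverse d \<in> D" if d: "d \<in> D" "d \<noteq> 0" for d
  proof (rule ccontr)
    assume nd: "inverse d \<notin> D"
    have dK: "d \<in> K" "inverse d \<in> K" using d D_sub_K K_inverse by auto
    then have "inverse d \<notin> R" using nd R_Int_K by blast
    then obtain i j u where u: "r_unit R u" "d ^ i = u * a ^ j" "i > 0" "j > 0"
      using a d D_sub_R unfolding almost_unif_param_def r_unit_def by blast
    have "u * a ^ (j - 1) * a \<in> M"
      using aM M_sub_V u(1) R_sub_V unfolding r_unit_def by (intro M_mult V_intros) auto
    moreover have "u * a ^ (j - 1) * a = d ^ i" using u by (cases j) (auto simp: mult_ac)
    ultimately have "d ^ i \<in> M" by simp
    then show False using K_Int_M[of "d ^ i"] K_intros(7) dK d by simp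
  qed
  then have "is_field_set D" unfolding is_field_set_def by blast
  then show ?thesis using that a aM a0 by blast
qed

text \<open>For \<open>k * a\<close> the parameter gives \<open>k ^ i * a ^ i = u * a ^ j\<close>.
  Both \<open>k ^ i\<close> and \<open>u\<close> are units of \<open>V\<close> and \<open>a\<close>
  is not, so \<open>i = j\<close> and \<open>k ^ i = u\<close> lies in \<open>R\<close>.\<close>

lemma RAV_root_ext:
  assumes "RAV_domain R"
  shows "root_ext D K"
  unfolding root_ext_def
proof
  fix k assume k: "k \<in> K"
  obtain a where a: "almost_unif_param R a" "a \<in> M" "a \<noteq> 0" "is_field_set D" using RAV_param[OF assms] .
  show "\<exists>n>0. k ^ n \<in> D"
  proof (cases "k = 0")
    case True
    then show ?thesis using D_intros(1) by (intro exI[of _ 1]) auto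
  next
    case False
    have ka: "k * a \<in> M" using M_mult a(2) k K_sub_V by blast
    then have "\<not> r_unit R (k * a)" using unit_R_iff[OF a(4)] by blast
    moreover have "k * a \<in> R" "k * a \<noteq> 0" using ka M_sub_R False a(3) by auto
    ultimately obtain i j u where u: "r_unit R u" "(k * a) ^ i = u * a ^ j" "i > 0"
      using a(1) unfolding almost_unif_param_def by blast
    have uV: "r_unit V u" using u(1) unit_R_unit_V by blast
    have kV: "r_unit V (k ^ i)" using k False K_inverse K_sub_V
      by (intro unit_power) (auto simp: r_unit_def)
    have aMp: "w * a ^ l \<in> M" if "l > 0" "r_unit V w" for l w
    proof -
      have "w * a ^ (l - 1) * a \<in> M"
        using that a(2) M_sub_V unfolding r_unit_def by (intro M_mult V_intros) auto
      then show ?thesis using that by (cases l) (auto simp: mult_ac)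
    qed
    have eq: "k ^ i * a ^ i = u * a ^ j" using u(2) by (simp add: power_mult_distrib)
    have "\<not> i < j"
    proof
      assume "i < j"
      then have "k ^ i = u * a ^ (j - i)" using eq a(3) by (simp add: power_diff field_simps)
      then show False using aMp[of "j - i" u] \<open>i < j\<close> uV kV unit_iff by simp
    qed
    moreover have "\<not> j < i"
    proof
      assume "j < i"
      then have "u = k ^ i * a ^ (i - j)" using eq a(3) by (simp add: power_diff field_simps)
      then show False using aMp[of "i - j" "k ^ i"] \<open>j < i\<close> uV kV unit_iff by simp
    qed
    ultimately have "k ^ i = u" using eq a(3) by simp
    then have "k ^ i \<in> D" using u(1) R_Int_K K_intros(7) k unfolding r_unit_def by blast
    then show ?thesis using u(3) by blast
  qed
qed

text \<open>The relation \<open>?rel x q\<close> below says that \<open>q\<close> is the value of \<open>x\<close> when \<open>a\<close> has value \<open>1\<close>.\<close>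
lemma RAV_rational:
  assumes "RAV_domain R"
  shows "rational_valuation_domain V"
proof -
  obtain a where a: "almost_unif_param R a" "a \<in> M" "a \<noteq> 0" "is_field_set D" using RAV_param[OF assms] .
  let ?rel = "\<lambda>x q. \<exists>(m::nat) (n::int) u. m > 0 \<and> r_unit V u \<and> q = (of_int n / of_nat m :: rat)
    \<and> x ^ m = u * a powi n"
  \<comment> \<open>The sign of the exponent of \<open>a\<close> decides membership in
    \<open>V\<close>; this makes the assigned values reflect \<open>V\<close>.\<close>
  have powi: "u * a powi n \<in> V \<longleftrightarrow> 0 \<le> n" if u: "r_unit V u" for u n
  proof
    assume "0 \<le> n"
    then show "u * a powi n \<in> V" using u a(2) M_sub_V unfolding r_unit_def
      by (auto simp: power_int_def intro!: V_intros)
  next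
    assume inV: "u * a powi n \<in> V"
    show "0 \<le> n"
    proof (rule ccontr)
      assume "\<not> 0 \<le> n"
      then have n: "nat (- n) > 0" "a powi n = inverse a ^ nat (- n)" by (auto simp: power_int_def)
      have "inverse u * (u * a powi n) \<in> V" using inV u V_intros(4) unfolding r_unit_def by blast
      then have "a powi n \<in> V" using u unfolding r_unit_def by (simp add: field_simps)
      then have "inverse a \<in> V" unfolding n(2) power_in_V[OF n(1)] .
      then show False using a M_iff by blast
    qed
  qed
  have sgn: "x \<in> V \<longleftrightarrow> 0 \<le> q" if rel: "?rel x q" for x q
  proof -
    obtain m n u where *: "m > 0" "r_unit V u" "q = (of_int n / of_nat m :: rat)" "x ^ m = u * a powi n"
      using rel by blast
    have "x \<in> V \<longleftrightarrow> 0 \<le> n" using power_in_V[OF *(1), of x] powi[OF *(2), of n] *(4) by simp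
    also have "\<dots> \<longleftrightarrow> 0 \<le> q" using *(1) unfolding *(3) by (simp add: zero_le_divide_iff)
    finally show ?thesis .
  qed
  have mult: "?rel (x * y) (q + q')" if rel: "?rel x q" "?rel y q'" for x y q q'
  proof -
    obtain m n u where x: "m > 0" "r_unit V u" "q = (of_int n / of_nat m :: rat)" "x ^ m = u * a powi n"
      using rel(1) by blast
    obtain m' n' u' where y: "m' > 0" "r_unit V u'" "q' = (of_int n' / of_nat m' :: rat)" "y ^ m' = u' * a powi n'"
      using rel(2) by blast
    \<comment> \<open>Both relations are raised to the common exponent \<open>m * m'\<close>, which
      adds the fractions.\<close>
    have px: "x ^ (m * m') = u ^ m' * a powi (n * int m')"
      unfolding power_mult x(4) by (simp add: power_mult_distrib power_int_mult)
    have "y ^ (m' * m) = u' ^ m * a powi (n' * int m)"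
      unfolding power_mult y(4) by (simp add: power_mult_distrib power_int_mult)
    then have "(x * y) ^ (m * m') = (u ^ m' * u' ^ m) * a powi (n * int m' + n' * int m)"
      using px a(3) by (simp add: power_mult_distrib power_int_add mult_ac)
    moreover have "q + q' = of_int (n * int m' + n' * int m) / of_nat (m * m')"
      using x(1) y(1) unfolding x(3) y(3) by (simp add: field_simps)
    moreover have "r_unit V (u ^ m' * u' ^ m)" using x y unit_mult unit_power by blast
    ultimately show ?thesis using x(1) y(1) by (metis nat_0_less_mult_iff)
  qed
  have inv: "?rel (inverse x) (- q)" if rel: "?rel x q" for x q
  proof -
    obtain m n u where x: "m > 0" "r_unit V u" "q = (of_int n / of_nat m :: rat)" "x ^ m = u * a powi n"
      using rel by blast
    have "inverse x ^ m = inverse u * a powi (- n)"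
      using x(4) by (simp add: power_inverse power_int_minus)
    moreover have "- q = of_int (- n) / of_nat m" using x(3) by simp
    ultimately show ?thesis using x(1) unit_inverse[OF x(2)] by blast
  qed
  have exM: "\<exists>q. ?rel x q" if x: "x \<in> M" "x \<noteq> 0" for x
  proof -
    have "\<not> r_unit R x" using x unit_R_iff[OF a(4)] by blast
    then obtain m n u where u: "m > 0" "r_unit R u" "x ^ m = u * a ^ n"
      using a(1) x M_sub_R unfolding almost_unif_param_def by blast
    then have "x ^ m = u * a powi (int n)" by simp
    then show ?thesis using u unit_R_unit_V by blast
  qed
  have ex: "\<exists>q. ?rel x q" if x: "x \<noteq> 0" for x
  proof -
    consider "r_unit V x" | "x \<in> M" | "inverse x \<in> M" using not_in_V[of x] unit_iff[of x] by blast
    then show ?thesis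
    proof cases
      case 1
      then have "?rel x 0" by (intro exI[of _ 1] exI[of _ 0] exI[of _ x]) auto
      then show ?thesis by blast
    next
      case 2
      then show ?thesis using exM x by blast
    next
      case 3
      then obtain q where "?rel (inverse x) q" using exM x by (meson inverse_nonzero_iff_nonzero)
      from inv[OF this] show ?thesis by (metis inverse_inverse_eq)
    qed
  qed
  \<comment> \<open>Uniqueness of the value: \<open>1 = x * inverse x\<close> receives
    \<open>q - q'\<close>, which is nonnegative because \<open>1 \<in> V\<close>. Exchanging
    \<open>q\<close> and \<open>q'\<close> gives equality.\<close>
  have le: "q' \<le> q" if rel: "?rel x q" "?rel x q'" and x: "x \<noteq> 0" for x q q'
  proof -
    have "?rel (x * inverse x) (q + - q')" by (rule mult[OF rel(1) inv[OF rel(2)]])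
    from sgn[OF this] show ?thesis using x V_intros(2) by simp
  qed
  define v where "v x = (SOME q. ?rel x q)" for x
  have v: "?rel x (v x)" if "x \<noteq> 0" for x
    unfolding v_def by (rule someI_ex[OF ex[OF that]])
  have "v (x * y) = v x + v y" if xy: "x \<noteq> 0" "y \<noteq> 0" for x y
  proof -
    have nz: "x * y \<noteq> 0" using xy by simp
    have r1: "?rel (x * y) (v x + v y)" by (rule mult[OF v[OF xy(1)] v[OF xy(2)]])
    have r2: "?rel (x * y) (v (x * y))" by (rule v[OF nz])
    show ?thesis using le[OF r1 r2 nz] le[OF r2 r1 nz] by (rule antisym)
  qed
  moreover have "x \<in> V \<longleftrightarrow> 0 \<le> v x" if "x \<noteq> 0" for x by (rule sgn[OF v[OF that]])
  ultimately show ?thesis unfolding rational_valuation_domain_def using val by blast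
qed

text \<open>Any nonzero \<open>a \<in> M\<close> serves. As \<open>v y / v a\<close> is a positive
  rational, powers of \<open>y\<close> and \<open>a\<close> have equal value and differ by a unit of
  \<open>V\<close>, a power of which lies in \<open>R\<close>.\<close>

lemma rational_RAV:
  assumes "rational_valuation_domain V" "is_field_set D" "root_ext D K"
  shows "RAV_domain R"
proof -
  obtain v :: "'a \<Rightarrow> rat" where v_mult: "\<And>x y. x \<noteq> 0 \<Longrightarrow> y \<noteq> 0 \<Longrightarrow> v (x * y) = v x + v y"
    and v_V: "\<And>x. x \<noteq> 0 \<Longrightarrow> x \<in> V \<longleftrightarrow> 0 \<le> v x"
    using assms(1) unfolding rational_valuation_domain_def by blast
  have v1: "v 1 = 0" using v_mult[of 1 1] by simp
  have v_inv: "v (inverse x) = - v x" if "x \<noteq> 0" for x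
    using v_mult[of x "inverse x"] that v1 by simp
  have v_pow: "v (x ^ n) = of_nat n * v x" if "x \<noteq> 0" for x n
    by (induction n) (use that v1 v_mult in \<open>auto simp: algebra_simps\<close>)
  have v_M: "0 < v x" if "x \<in> M" "x \<noteq> 0" for x
    using that M_iff[of x] v_V[of x] v_V[of "inverse x"] v_inv[of x] by auto
  obtain a where a: "a \<in> M" "a \<noteq> 0" using obtain_M .
  have "almost_unif_param R a"
    unfolding almost_unif_param_def
  proof (intro conjI ballI impI)
    show "a \<in> R" using a M_sub_R by blast
    fix y assume y: "y \<in> R" "y \<noteq> 0" "\<not> r_unit R y"
    then have yM: "y \<in> M" using unit_R_iff[OF assms(2)] by blast
    define q where "q = v y / v a"
    have q0: "0 < q" unfolding q_def using v_M yM y(2) a by simp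
    obtain i j where ij: "q = of_int i / of_int j" "j > 0" using quotient_of_div quotient_of_denom_pos
      by (metis surj_pair)
    have i0: "i > 0" using q0 ij by (simp add: zero_less_divide_iff)
    define m n where "m = nat j" and "n = nat i"
    have mn: "m > 0" "n > 0" "of_nat m * v y = of_nat n * v a"
    proof -
      show "m > 0" "n > 0" using ij i0 unfolding m_def n_def by auto
      have "v y / v a = of_int i / of_int j" using ij(1) unfolding q_def .
      then show "of_nat m * v y = of_nat n * v a" unfolding m_def n_def
        using ij(2) i0 v_M[OF a] by (simp add: field_simps)
    qed
    define w where "w = y ^ m * inverse (a ^ n)"
    have w0: "w \<noteq> 0" using y a unfolding w_def by simp
    have "v w = 0" using y(2) a mn(3) unfolding w_def by (simp add: v_mult v_inv v_pow)
    then have w: "r_unit V w" unfolding r_unit_def using w0 v_V[of w] v_V[of "inverse w"] v_inv[of w] by simp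
    \<comment> \<open>The unit \<open>w\<close> belongs to \<open>V\<close> only; replacing it by
      \<open>w ^ k\<close> multiplies both exponents by \<open>k\<close>.\<close>
    then obtain k where k: "k > 0" "w ^ k \<in> R" using root_ext_V[OF assms(3)] unfolding r_unit_def by blast
    have "w ^ k \<notin> M" using unit_power[OF w] unit_iff by blast
    then have "r_unit R (w ^ k)" using unit_R_iff[OF assms(2)] k(2) by blast
    moreover have "y ^ m = w * a ^ n" using a(2) unfolding w_def by simp
    then have "y ^ (m * k) = w ^ k * a ^ (n * k)" by (simp add: power_mult power_mult_distrib)
    ultimately show "\<exists>m>0. \<exists>n>0. \<exists>u. r_unit R u \<and> y ^ m = u * a ^ n"
      using mn(1,2) k(1) by (metis nat_0_less_mult_iff)
  qed
  moreover have "\<not> is_field_set R"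
    using a M_iff[of a] M_sub_R R_sub_V unfolding is_field_set_def by blast
  ultimately show ?thesis unfolding RAV_domain_def by blast
qed

end

theorem theorem13:
  fixes V M K D F R :: "'a::field set"
  assumes "valuation_domain V"
    and "M = max_ideal_of V"
    and "M \<noteq> {0}"
    and "is_subfield K" and "K \<subseteq> V"
    and "V = set_plus K M"
    and "is_subring D" and "D \<subseteq> K"
    and "F = frac_field D"
    and "R = set_plus D M"
  shows "(local_dom R \<and> AV_domain R \<longleftrightarrow>
            is_DVR V \<and> D = F \<and> fin_dim F K \<and> root_ext F K)
       \<and> (quasilocal R \<and> API_domain R \<longleftrightarrow>
            is_DVR V \<and> D = F \<and> bounded_root_ext F K)
       \<and> (local_dom R \<and> API_domain R \<longleftrightarrow>
            is_DVR V \<and> D = F \<and> fin_dim F K \<and> bounded_root_ext F K)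
       \<and> (RAV_domain R \<longleftrightarrow>
            rational_valuation_domain V \<and> D = F \<and> root_ext F K)"
proof -
  interpret D_plus_M V M K D R
    by unfold_locales (rule assms)+
  have DF: "D = F \<longleftrightarrow> is_field_set D"
    unfolding assms(9) by (rule frac_field_eq_iff[OF assms(7)])
  have noeth: "is_DVR V \<and> is_field_set D \<and> fin_dim D K" if "noetherian R"
    using that noetherian_ACCP[OF that R_subring] ACCP_DVR ACCP_D_field noetherian_fin_dim by blast
  have api: "is_DVR V \<and> is_field_set D \<and> bounded_root_ext D K" if "API_domain R"
    using that API_ACCP[OF that R_subring] ACCP_DVR ACCP_D_field API_bounded_root_ext by blast
  show ?thesis
  \<comment> \<open>When \<open>D\<close> is a field, each property is characterised separately and
    the equivalences combine propositionally. Otherwise both sides of each equivalence fail, as the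
    Noetherian, API and RAV properties each force \<open>D\<close> to be a field.\<close>
  proof (cases "D = F")
    case True
    then have D: "is_field_set D" using DF by blast
    have "local_dom R \<longleftrightarrow> is_DVR V \<and> fin_dim D K"
      unfolding local_dom_def using D noeth fin_dim_noetherian R_quasilocal by blast
    moreover have "AV_domain R \<longleftrightarrow> root_ext D K" using D AV_root_ext root_ext_AV by blast
    moreover have "API_domain R \<longleftrightarrow> is_DVR V \<and> bounded_root_ext D K"
      using api bounded_root_ext_API by blast
    moreover have "RAV_domain R \<longleftrightarrow> rational_valuation_domain V \<and> root_ext D K"
      using D RAV_root_ext RAV_rational rational_RAV by blast
    ultimately show ?thesis using R_quasilocal[OF D] unfolding True[symmetric] by blast
  next
    case False
    then have "\<not> is_field_set D" using DF by blast
    then have "\<not> noetherian R" "\<not> API_domain R" "\<not> RAV_domain R"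
      using noeth api RAV_param by blast+
    then show ?thesis using False unfolding local_dom_def by blast
  qed
qed

end
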